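(* Consider the mean-spherical 120$^\circ$-model on $\mathbb T_L$ with Hamiltonian $\mathscr H_L$ and constraint term $\mathscr N_L$ as below, and let $\langle-\rangle_{L,\beta,\mu}$ be the expectation with respect to the probability measure on $(\mathbb R^2)^{\mathbb T_L}$ with density proportional to $e^{-\beta\mathscr H_L-\mu\mathscr N_L}$. There exists a positive real-analytic function $\mu_\star:(0,\infty)\to(0,\infty)$ such that for each $\beta\in(0,\infty)$, with $\mu=\mu_\star(\beta)$: (i) $\lim_{L\to\infty}L^{-3}\langle\mathscr N_L\rangle_{L,\beta,\mu_\star(\beta)}=1$; (ii) $\lim_{L\to\infty}\bigl\langle|L^{-3}\sum_{\boldsymbol r\in\mathbb T_L}\boldsymbol S_{\boldsymbol r}|^2\bigr\rangle_{L,\beta,\mu_\star(\beta)}=0$; (iii) for all $\alpha,\alpha'\in\{x,y\}$, $\lim_{|\boldsymbol r-\boldsymbol r'|\to\infty}\lim_{L\to\infty}\langle S^{(\alpha)}_{\boldsymbol r}S^{(\alpha')}_{\boldsymbol r'}\rangle_{L,\beta,\mu_\star(\beta)}=0$. Moreover, the limiting free energy $\beta\mapsto\lim_{L\to\infty}L^{-3}\log Z_L(\beta,\mu_\star(\beta))$ is a real-analytic function of $\beta\in(0,\infty)$, where $Z_L(\beta,\mu)=\int_{(\mathbb R^2)^{\mathbb T_L}}e^{-\beta\mathscr H_L-\mu\mathscr N_L}\prod d\boldsymbol S_{\boldsymbol r}$.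
   Context: Here $\boldsymbol S_{\boldsymbol r}=(S^{(x)}_{\boldsymbol r},S^{(y)}_{\boldsymbol r})\in\mathbb R^2$ are unrestricted, with a priori Lebesgue measure. With $\hat{\mathrm a}=(1,0)$, $\hat{\mathrm b}=(-\tfrac12,\tfrac{\sqrt3}2)$, $\hat{\mathrm c}=(-\tfrac12,-\tfrac{\sqrt3}2)$, $J>0$, the Hamiltonian on $\mathbb T_L=\mathbb Z^3/(L\mathbb Z)^3$ is $\mathscr H_L=\frac J2\sum_{\boldsymbol r\in\mathbb T_L}\bigl[(\boldsymbol S_{\boldsymbol r}\cdot\hat{\mathrm a}-\boldsymbol S_{\boldsymbol r+\hat{\mathrm e}_x}\cdot\hat{\mathrm a})^2+(\boldsymbol S_{\boldsymbol r}\cdot\hat{\mathrm b}-\boldsymbol S_{\boldsymbol r+\hat{\mathrm e}_y}\cdot\hat{\mathrm b})^2+(\boldsymbol S_{\boldsymbol r}\cdot\hat{\mathrm c}-\boldsymbol S_{\boldsymbol r+\hat{\mathrm e}_z}\cdot\hat{\mathrm c})^2\bigr]$, and $\mathscr N_L=\sum_{\boldsymbol r\in\mathbb T_L}\bigl((S^{(x)}_{\boldsymbol r})^2+(S^{(y)}_{\boldsymbol r})^2\bigr)$. *)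

theory Defs
  imports "HOL-Analysis.Analysis"
begin

text \<open>Sites of the torus T_L = (Z/LZ)^3, represented by coordinates in {0..<L}.\<close>
type_synonym site = "nat \<times> nat \<times> nat"
type_synonym config = "site \<Rightarrow> real \<times> real"

definition sites :: "nat \<Rightarrow> site set" where
  "sites L = {0..<L} \<times> {0..<L} \<times> {0..<L}"

definition shift_x :: "nat \<Rightarrow> site \<Rightarrow> site" where
  "shift_x L r = (case r of (x, y, z) \<Rightarrow> ((x + 1) mod L, y, z))"
definition shift_y :: "nat \<Rightarrow> site \<Rightarrow> site" where
  "shift_y L r = (case r of (x, y, z) \<Rightarrow> (x, (y + 1) mod L, z))"
definition shift_z :: "nat \<Rightarrow> site \<Rightarrow> site" where
  "shift_z L r = (case r of (x, y, z) \<Rightarrow> (x, y, (z + 1) mod L))"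

definition site_of :: "nat \<Rightarrow> int \<times> int \<times> int \<Rightarrow> site" where
  "site_of L r = (case r of (a, b, c) \<Rightarrow>
     (nat (a mod int L), nat (b mod int L), nat (c mod int L)))"

definition euclid_dist3 :: "int \<times> int \<times> int \<Rightarrow> int \<times> int \<times> int \<Rightarrow> real" where
  "euclid_dist3 r r' = (case r of (a, b, c) \<Rightarrow> case r' of (a', b', c') \<Rightarrow>
     sqrt (real_of_int ((a - a')^2 + (b - b')^2 + (c - c')^2)))"

definition vec_a :: "real \<times> real" where "vec_a = (1, 0)"
definition vec_b :: "real \<times> real" where "vec_b = (-1/2, sqrt 3 / 2)"
definition vec_c :: "real \<times> real" where "vec_c = (-1/2, - sqrt 3 / 2)"

definition hamiltonian :: "real \<Rightarrow> nat \<Rightarrow> config \<Rightarrow> real" where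
  "hamiltonian J L S = J / 2 * (\<Sum>r\<in>sites L.
      (S r \<bullet> vec_a - S (shift_x L r) \<bullet> vec_a)^2
    + (S r \<bullet> vec_b - S (shift_y L r) \<bullet> vec_b)^2
    + (S r \<bullet> vec_c - S (shift_z L r) \<bullet> vec_c)^2)"

definition constraint :: "nat \<Rightarrow> config \<Rightarrow> real" where
  "constraint L S = (\<Sum>r\<in>sites L. (fst (S r))^2 + (snd (S r))^2)"

definition config_measure :: "nat \<Rightarrow> config measure" where
  "config_measure L = PiM (sites L) (\<lambda>_. lborel)"

definition gibbs_weight :: "real \<Rightarrow> nat \<Rightarrow> real \<Rightarrow> real \<Rightarrow> config \<Rightarrow> real" where
  "gibbs_weight J L \<beta> \<mu> S = exp (- \<beta> * hamiltonian J L S - \<mu> * constraint L S)"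

definition partition_fn :: "real \<Rightarrow> nat \<Rightarrow> real \<Rightarrow> real \<Rightarrow> real" where
  "partition_fn J L \<beta> \<mu> = (\<integral>S. gibbs_weight J L \<beta> \<mu> S \<partial>config_measure L)"

definition gibbs_expect :: "real \<Rightarrow> nat \<Rightarrow> real \<Rightarrow> real \<Rightarrow> (config \<Rightarrow> real) \<Rightarrow> real" where
  "gibbs_expect J L \<beta> \<mu> f =
     (\<integral>S. f S * gibbs_weight J L \<beta> \<mu> S \<partial>config_measure L) / partition_fn J L \<beta> \<mu>"

definition real_analytic_on :: "(real \<Rightarrow> real) \<Rightarrow> real set \<Rightarrow> bool" where
  "real_analytic_on f A \<longleftrightarrow> (\<forall>x\<in>A. \<exists>\<rho>>0. \<exists>a::nat \<Rightarrow> real.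
     \<forall>y. \<bar>y - x\<bar> < \<rho> \<longrightarrow> (\<lambda>n. a n * (y - x)^n) sums f y)"

end

theory Submission
  imports Defs "HOL-Probability.Distributions" "HOL-Complex_Analysis.Conformal_Mappings"
    "HOL-Real_Asymp.Real_Asymp"
begin

text \<open>
  With \<open>\<kappa> = \<beta> J\<close> and \<open>\<tau> = 2 \<mu>\<close> the weight is \<open>exp (- Q(S, S) / 2)\<close>, where \<open>Q\<close> is the form of
  \<open>T - \<kappa> B\<close> with \<open>T = 6 \<kappa> + \<tau>\<close> and \<open>B\<close> a translation invariant nearest-neighbour operator with
  \<open>0 \<le> B \<le> 6\<close>. Hence the covariance is the Neumann series
  \<open>\<Sum>n. \<kappa>^n / T^(n+1) B^n\<close>. The matrix elements of \<open>B^n\<close> on the torus agree with those on \<open>\<int>^3\<close> as soon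
  as \<open>L\<close> exceeds \<open>n\<close> plus the distance, and they vanish beyond distance \<open>n\<close>; dominated convergence
  then gives all the limits and the decay of correlations.

  Let \<open>m n\<close> be the trace of the diagonal block of \<open>B^n\<close> and \<open>v = \<kappa> / T\<close>. The limiting constraint is
  \<open>spin_density v / \<kappa>\<close> with \<open>spin_density v = \<Sum>n. m n v^(n+1)\<close>, a power series with nonnegative coefficients, so
  \<open>\<mu>\<^sub>s\<close> comes from solving \<open>spin_density v = \<kappa>\<close>. A solution exists for every \<open>\<kappa>\<close> because \<open>spin_density\<close> is unbounded
  on \<open>(0, 1/6)\<close>: a field supported on a lattice plane and orthogonal to the coupling direction normal
  to that plane only feels a two-dimensional Dirichlet energy, and the plane is recurrent. The solution
  is analytic by the holomorphic inverse function theorem. The free energy is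
  \<open>ln (2 \<pi>) - ln T + (\<Sum>n. m n v^n / n) / 2\<close>, where the sum runs over \<open>n \<ge> 1\<close>, obtained by integrating its \<open>\<tau>\<close>-derivative, which is
  minus half the mean constraint per site, from \<open>\<tau> = \<infinity>\<close>.
\<close>

section \<open>The hopping operator on the lattice\<close>

type_synonym lattice_site = "int \<times> int \<times> int"
type_synonym lattice_field = "lattice_site \<Rightarrow> real \<times> real"

text \<open>Since \<open>a mod 0 = a\<close>, taking \<open>L = 0\<close> in \<open>reduce\<close>, \<open>delta\<close>,
  \<open>hop_kernel\<close>, \<open>moment\<close> and \<open>resolvent\<close> gives the objects of the infinite lattice.\<close>

definition reduce :: "nat \<Rightarrow> lattice_site \<Rightarrow> lattice_site" where
  "reduce L r = (case r of (a, b, c) \<Rightarrow> (a mod int L, b mod int L, c mod int L))"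

definition cell :: "nat \<Rightarrow> lattice_site set" where
  "cell L = {0..<int L} \<times> {0..<int L} \<times> {0..<int L}"

text \<open>Torus fields are kept as invariant functions on the whole lattice, so that neighbours
  are reached by plain addition, without wraparound.\<close>

definition periodic :: "nat \<Rightarrow> (lattice_site \<Rightarrow> 'a) \<Rightarrow> bool" where
  "periodic L f \<longleftrightarrow> (\<forall>r. f (reduce L r) = f r)"

definition unit_x :: lattice_site where "unit_x = (1, 0, 0)"
definition unit_y :: lattice_site where "unit_y = (0, 1, 0)"
definition unit_z :: lattice_site where "unit_z = (0, 0, 1)"

definition inner_torus :: "nat \<Rightarrow> lattice_field \<Rightarrow> lattice_field \<Rightarrow> real" where
  "inner_torus L f g = (\<Sum>r\<in>cell L. f r \<bullet> g r)"

text \<open>Kept bilinear so that polarisation and self-adjointness are available; the Hamiltonian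
  is \<open>J / 2\<close> times the diagonal of \<open>energy\<close>.\<close>

definition energy_dir :: "nat \<Rightarrow> lattice_site \<Rightarrow> real \<times> real \<Rightarrow> lattice_field \<Rightarrow> lattice_field \<Rightarrow> real" where
  "energy_dir L e v f g = (\<Sum>r\<in>cell L. ((f r - f (r + e)) \<bullet> v) * ((g r - g (r + e)) \<bullet> v))"

definition energy :: "nat \<Rightarrow> lattice_field \<Rightarrow> lattice_field \<Rightarrow> real" where
  "energy L f g = energy_dir L unit_x vec_a f g + energy_dir L unit_y vec_b f g + energy_dir L unit_z vec_c f g"

definition stencil :: "lattice_site \<Rightarrow> real \<times> real \<Rightarrow> lattice_field \<Rightarrow> lattice_field" where
  "stencil e v f r = ((2 *\<^sub>R f r + f (r + e) + f (r - e)) \<bullet> v) *\<^sub>R v"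

text \<open>The interaction operator \<open>A\<close>, defined by \<open>energy L f g = inner_torus L f (A g)\<close>, equals \<open>6 - hop\<close> because the
  three spin directions form a tight frame; \<open>hop\<close> is \<open>A\<close> with every difference replaced by a sum.\<close>

definition hop :: "lattice_field \<Rightarrow> lattice_field" where
  "hop f r = stencil unit_x vec_a f r + stencil unit_y vec_b f r + stencil unit_z vec_c f r"

definition delta :: "nat \<Rightarrow> lattice_site \<Rightarrow> real \<times> real \<Rightarrow> lattice_field" where
  "delta L r\<^sub>0 w r = (if reduce L (r - r\<^sub>0) = 0 then w else 0)"

definition hop_kernel :: "nat \<Rightarrow> nat \<Rightarrow> real \<times> real \<Rightarrow> lattice_field" where
  "hop_kernel n L w = (hop ^^ n) (delta L 0 w)"

definition quad_form :: "real \<Rightarrow> real \<Rightarrow> nat \<Rightarrow> lattice_field \<Rightarrow> lattice_field \<Rightarrow> real" where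
  "quad_form \<kappa> \<tau> L f g = \<kappa> * energy L f g + \<tau> * inner_torus L f g"

section \<open>Periodic fields and sums over a fundamental cell\<close>

lemma finite_cell [simp]: "finite (cell L)"
  by (simp add: cell_def)

lemma card_cell: "card (cell L) = L ^ 3"
  by (simp add: cell_def card_cartesian_product power3_eq_cube)

lemma reduce_in_cell: "L > 0 \<Longrightarrow> reduce L r \<in> cell L"
  by (auto simp: reduce_def cell_def split: prod.splits)

lemma reduce_id: "r \<in> cell L \<Longrightarrow> reduce L r = r"
  by (auto simp: reduce_def cell_def)

lemma reduce_0 [simp]: "reduce 0 r = r"
  by (auto simp: reduce_def)

lemma reduce_zero [simp]: "reduce L 0 = 0"
  by (simp add: reduce_def zero_prod_def)

lemma reduce_add: "reduce L (reduce L r + e) = reduce L (r + e)"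
  by (cases r; cases e) (simp add: reduce_def mod_simps)

lemma reduce_diff: "reduce L (reduce L r - e) = reduce L (r - e)"
  by (cases r; cases e) (simp add: reduce_def mod_simps)

lemma periodicD: "periodic L f \<Longrightarrow> f (reduce L r) = f r"
  unfolding periodic_def by blast

lemma periodic_shift: "periodic L f \<Longrightarrow> periodic L (\<lambda>r. f (r + e))"
  unfolding periodic_def by (metis reduce_add)

lemma periodic_shift_diff: "periodic L f \<Longrightarrow> periodic L (\<lambda>r. f (r - e))"
  unfolding periodic_def by (metis reduce_diff)

text \<open>Shifting and then reducing permutes \<open>cell L\<close>. This is the discrete
  integration by parts behind the operator identities that follow.\<close>

lemma sum_cell_shift:
  assumes "periodic L f" "L > 0"
  shows "(\<Sum>r\<in>cell L. f (r + e)) = (\<Sum>r\<in>cell L. f r)"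
proof (rule sum.reindex_bij_witness[where i = "\<lambda>r. reduce L (r - e)" and j = "\<lambda>r. reduce L (r + e)"])
  fix a assume a: "a \<in> cell L"
  show "reduce L (reduce L (a + e) - e) = a" using a by (simp add: reduce_diff reduce_id)
  show "reduce L (reduce L (a - e) + e) = a" using a by (simp add: reduce_add reduce_id)
  show "f (reduce L (a + e)) = f (a + e)" using assms(1) by (rule periodicD)
qed (use assms in \<open>auto intro: reduce_in_cell\<close>)

lemma periodic_stencil: "periodic L f \<Longrightarrow> periodic L (stencil e v f)"
  using periodic_shift[of L f e] periodic_shift_diff[of L f e]
  by (simp add: stencil_def periodic_def)

lemma periodic_hop: "periodic L f \<Longrightarrow> periodic L (hop f)"
  using periodic_stencil[of L f unit_x vec_a] periodic_stencil[of L f unit_y vec_b] periodic_stencil[of L f unit_z vec_c]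
  by (simp add: hop_def periodic_def)

lemma periodic_hop_funpow: "periodic L f \<Longrightarrow> periodic L ((hop ^^ n) f)"
  by (induction n) (auto intro: periodic_hop)

lemma periodic_delta [simp]: "periodic L (delta L r w)"
  by (simp add: periodic_def delta_def reduce_diff)

lemma periodic_hop_kernel [simp]: "periodic L (hop_kernel n L w)"
  by (simp add: hop_kernel_def periodic_hop_funpow)

section \<open>Summation by parts and the spectral bounds of \<open>hop\<close>\<close>

text \<open>A shift of the sum moves the backward neighbour of \<open>g\<close> onto
  \<open>f\<close>, and another moves one of the two diagonal sums to \<open>r + e\<close>. The
  plus-sign form so obtained is a sum of squares when \<open>f = g\<close>.\<close>

lemma inner_torus_stencil:
  assumes "periodic L f" "periodic L g" "L > 0"
  shows "inner_torus L f (stencil e v g) = (\<Sum>r\<in>cell L. ((f r + f (r + e)) \<bullet> v) * ((g r + g (r + e)) \<bullet> v))"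
proof -
  have p1: "periodic L (\<lambda>r. (f r \<bullet> v) * (g (r - e) \<bullet> v))"
    using assms(1) periodic_shift_diff[OF assms(2), of e] by (simp add: periodic_def)
  have p2: "periodic L (\<lambda>r. (f r \<bullet> v) * (g r \<bullet> v))"
    using assms by (simp add: periodic_def)
  have s1: "(\<Sum>r\<in>cell L. (f r \<bullet> v) * (g (r - e) \<bullet> v)) = (\<Sum>r\<in>cell L. (f (r + e) \<bullet> v) * (g r \<bullet> v))"
    using sum_cell_shift[OF p1 assms(3), of e] by simp
  have s2: "(\<Sum>r\<in>cell L. (f (r + e) \<bullet> v) * (g (r + e) \<bullet> v)) = (\<Sum>r\<in>cell L. (f r \<bullet> v) * (g r \<bullet> v))"
    using sum_cell_shift[OF p2 assms(3), of e] by simp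
  have "inner_torus L f (stencil e v g) = (\<Sum>r\<in>cell L. 2 * ((f r \<bullet> v) * (g r \<bullet> v)) + (f r \<bullet> v) * (g (r + e) \<bullet> v)
      + (f r \<bullet> v) * (g (r - e) \<bullet> v))"
    unfolding inner_torus_def stencil_def by (intro sum.cong) (auto simp: inner_simps algebra_simps)
  also have "\<dots> = 2 * (\<Sum>r\<in>cell L. (f r \<bullet> v) * (g r \<bullet> v)) + (\<Sum>r\<in>cell L. (f r \<bullet> v) * (g (r + e) \<bullet> v))
      + (\<Sum>r\<in>cell L. (f (r + e) \<bullet> v) * (g r \<bullet> v))"
    by (simp add: sum.distrib sum_distrib_left s1)
  also have "\<dots> = (\<Sum>r\<in>cell L. (f r \<bullet> v) * (g r \<bullet> v)) + (\<Sum>r\<in>cell L. (f r \<bullet> v) * (g (r + e) \<bullet> v))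
      + (\<Sum>r\<in>cell L. (f (r + e) \<bullet> v) * (g r \<bullet> v)) + (\<Sum>r\<in>cell L. (f (r + e) \<bullet> v) * (g (r + e) \<bullet> v))"
    using s2 by simp
  also have "\<dots> = (\<Sum>r\<in>cell L. ((f r + f (r + e)) \<bullet> v) * ((g r + g (r + e)) \<bullet> v))"
    by (simp add: sum.distrib[symmetric] inner_simps algebra_simps)
  finally show ?thesis .
qed

text \<open>The parallelogram law on each bond: the cross terms of the minus form and the plus form
  cancel, and the remaining diagonal sums agree after a shift.\<close>

lemma energy_dir_stencil:
  assumes "periodic L f" "periodic L g" "L > 0"
  shows "energy_dir L e v f g + inner_torus L f (stencil e v g) = 4 * (\<Sum>r\<in>cell L. (f r \<bullet> v) * (g r \<bullet> v))"
proof -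
  have p2: "periodic L (\<lambda>r. (f r \<bullet> v) * (g r \<bullet> v))"
    using assms by (simp add: periodic_def)
  have s2: "(\<Sum>r\<in>cell L. (f (r + e) \<bullet> v) * (g (r + e) \<bullet> v)) = (\<Sum>r\<in>cell L. (f r \<bullet> v) * (g r \<bullet> v))"
    using sum_cell_shift[OF p2 assms(3), of e] by simp
  have "energy_dir L e v f g + inner_torus L f (stencil e v g)
     = (\<Sum>r\<in>cell L. 2 * ((f r \<bullet> v) * (g r \<bullet> v)) + 2 * ((f (r + e) \<bullet> v) * (g (r + e) \<bullet> v)))"
    unfolding inner_torus_stencil[OF assms] energy_dir_def sum.distrib[symmetric]
    by (intro sum.cong) (auto simp: inner_simps algebra_simps)
  also have "\<dots> = 4 * (\<Sum>r\<in>cell L. (f r \<bullet> v) * (g r \<bullet> v))"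
    by (simp add: sum.distrib sum_distrib_left[symmetric] s2)
  finally show ?thesis .
qed

text \<open>Three unit vectors at mutual angles of 120 degrees form a tight frame whose constant is
  the number of vectors over the dimension. With the factor 4 of \<open>energy_dir_stencil\<close>
  this yields the 6 in \<open>energy_hop\<close>.\<close>

lemma frame_identity:
  "(x \<bullet> vec_a) * (y \<bullet> vec_a) + (x \<bullet> vec_b) * (y \<bullet> vec_b) + (x \<bullet> vec_c) * (y \<bullet> vec_c) = 3 / 2 * (x \<bullet> y)"
proof (cases x; cases y)
  fix a b c d assume "x = (a, b)" "y = (c, d)"
  moreover have "sqrt 3 * (sqrt 3 * z) = 3 * z" for z :: real
    by (simp flip: mult.assoc)
  ultimately show ?thesis
    by (simp add: vec_a_def vec_b_def vec_c_def field_simps)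
qed

lemma energy_hop:
  assumes "periodic L f" "periodic L g" "L > 0"
  shows "energy L f g + inner_torus L f (hop g) = 6 * inner_torus L f g"
proof -
  have "inner_torus L f (hop g) = inner_torus L f (stencil unit_x vec_a g) + inner_torus L f (stencil unit_y vec_b g) + inner_torus L f (stencil unit_z vec_c g)"
    by (simp add: inner_torus_def hop_def inner_simps sum.distrib)
  then have "energy L f g + inner_torus L f (hop g)
     = 4 * (\<Sum>r\<in>cell L. (f r \<bullet> vec_a) * (g r \<bullet> vec_a) + (f r \<bullet> vec_b) * (g r \<bullet> vec_b) + (f r \<bullet> vec_c) * (g r \<bullet> vec_c))"
    using energy_dir_stencil[OF assms, of unit_x vec_a] energy_dir_stencil[OF assms, of unit_y vec_b]
      energy_dir_stencil[OF assms, of unit_z vec_c]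
    by (simp add: energy_def sum.distrib)
  also have "\<dots> = 6 * inner_torus L f g"
    by (simp add: frame_identity inner_torus_def sum_distrib_left)
  finally show ?thesis .
qed

lemma inner_torus_sym: "inner_torus L f g = inner_torus L g f"
  by (simp add: inner_torus_def inner_commute)

lemma inner_torus_nonneg: "inner_torus L f f \<ge> 0"
  by (simp add: inner_torus_def sum_nonneg)

lemma energy_sym: "energy L f g = energy L g f"
  by (simp add: energy_def energy_dir_def mult.commute)

lemma energy_nonneg: "energy L f f \<ge> 0"
  by (simp add: energy_def energy_dir_def sum_nonneg)

lemma inner_torus_hop_sym:
  assumes "periodic L f" "periodic L g" "L > 0"
  shows "inner_torus L f (hop g) = inner_torus L (hop f) g"
  using energy_hop[OF assms] energy_hop[OF assms(2,1,3)] energy_sym[of L f g] inner_torus_sym[of L f g]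
    inner_torus_sym[of L "hop f" g]
  by simp

text \<open>The form is a sum of squares by \<open>inner_torus_stencil\<close>. Together with
  \<open>inner_torus_hop_le\<close> this places the spectrum of \<open>hop\<close> on the torus in
  [0, 6].\<close>

lemma inner_torus_hop_nonneg:
  assumes "periodic L f" "L > 0"
  shows "inner_torus L f (hop f) \<ge> 0"
proof -
  have "inner_torus L f (hop f) = inner_torus L f (stencil unit_x vec_a f) + inner_torus L f (stencil unit_y vec_b f) + inner_torus L f (stencil unit_z vec_c f)"
    by (simp add: inner_torus_def hop_def inner_simps sum.distrib)
  then show ?thesis
    using assms by (simp add: inner_torus_stencil sum_nonneg)
qed

lemma inner_torus_hop_le:
  assumes "periodic L f" "L > 0"
  shows "inner_torus L f (hop f) \<le> 6 * inner_torus L f f"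
  using energy_hop[OF assms(1,1,2)] energy_nonneg[of L f] by linarith

lemma stencil_lin: "stencil e v (\<lambda>r. f r + s *\<^sub>R g r) r = stencil e v f r + s *\<^sub>R stencil e v g r"
  by (simp add: stencil_def inner_simps algebra_simps)

lemma hop_lin: "hop (\<lambda>r. f r + s *\<^sub>R g r) = (\<lambda>r. hop f r + s *\<^sub>R hop g r)"
  by (rule ext) (simp add: hop_def stencil_lin algebra_simps)

lemma inner_torus_lin_left: "inner_torus L (\<lambda>r. f r + s *\<^sub>R g r) h = inner_torus L f h + s * inner_torus L g h"
  by (simp add: inner_torus_def inner_simps sum.distrib sum_distrib_left)

lemma inner_torus_lin_right: "inner_torus L h (\<lambda>r. f r + s *\<^sub>R g r) = inner_torus L h f + s * inner_torus L h g"
  by (simp add: inner_torus_def inner_simps sum.distrib sum_distrib_left)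

lemma energy_dir_lin_left:
  "energy_dir L e v (\<lambda>r. f r + s *\<^sub>R g r) h = energy_dir L e v f h + s * energy_dir L e v g h"
  unfolding energy_dir_def sum_distrib_left sum.distrib[symmetric]
  by (intro sum.cong) (auto simp: inner_simps algebra_simps)

lemma energy_lin_left: "energy L (\<lambda>r. f r + s *\<^sub>R g r) h = energy L f h + s * energy L g h"
  by (simp add: energy_def energy_dir_lin_left algebra_simps)

lemma quad_form_lin_left: "quad_form \<kappa> \<tau> L (\<lambda>r. f r + s *\<^sub>R g r) h = quad_form \<kappa> \<tau> L f h + s * quad_form \<kappa> \<tau> L g h"
  by (simp add: quad_form_def energy_lin_left inner_torus_lin_left algebra_simps)

lemma quad_form_sym: "quad_form \<kappa> \<tau> L f g = quad_form \<kappa> \<tau> L g f"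
  unfolding quad_form_def using energy_sym[of L f g] inner_torus_sym[of L f g] by simp

lemma quad_form_lin_right: "quad_form \<kappa> \<tau> L h (\<lambda>r. f r + s *\<^sub>R g r) = quad_form \<kappa> \<tau> L h f + s * quad_form \<kappa> \<tau> L h g"
  using quad_form_lin_left quad_form_sym by metis

lemma quad_form_nonneg: "\<kappa> \<ge> 0 \<Longrightarrow> \<tau> \<ge> 0 \<Longrightarrow> quad_form \<kappa> \<tau> L f f \<ge> 0"
  by (simp add: quad_form_def energy_nonneg inner_torus_nonneg)

lemma quad_form_eq_inner_torus:
  assumes "periodic L f" "periodic L g" "L > 0"
  shows "quad_form \<kappa> \<tau> L f g = (6 * \<kappa> + \<tau>) * inner_torus L f g - \<kappa> * inner_torus L f (hop g)"
proof -
  have "energy L f g = 6 * inner_torus L f g - inner_torus L f (hop g)"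
    using energy_hop[OF assms] by simp
  then show ?thesis
    unfolding quad_form_def by (simp only:) (simp add: algebra_simps)
qed

text \<open>Positivity of the form of \<open>hop\<close> at \<open>f - hop f / 6\<close>, combined with \<open>hop \<le> 6\<close>.\<close>

lemma inner_torus_hop_hop_le:
  assumes "periodic L f" "L > 0"
  shows "inner_torus L (hop f) (hop f) \<le> 36 * inner_torus L f f"
proof -
  let ?g = "hop f"
  have pg: "periodic L ?g" using assms(1) by (rule periodic_hop)
  let ?h = "\<lambda>r. f r + (-1/6) *\<^sub>R ?g r"
  have ph: "periodic L ?h" using assms(1) pg by (simp add: periodic_def)
  have "0 \<le> inner_torus L ?h (hop ?h)" by (rule inner_torus_hop_nonneg[OF ph assms(2)])
  also have "\<dots> = inner_torus L f (hop f) - 1/6 * inner_torus L f (hop ?g) - 1/6 * inner_torus L ?g ?g + 1/36 * inner_torus L ?g (hop ?g)"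
    unfolding hop_lin inner_torus_lin_left inner_torus_lin_right by (simp add: field_simps)
  also have "inner_torus L f (hop ?g) = inner_torus L ?g ?g"
    by (rule inner_torus_hop_sym[OF assms(1) pg assms(2)])
  finally have "0 \<le> inner_torus L f (hop f) - 1/3 * inner_torus L ?g ?g + 1/36 * inner_torus L ?g (hop ?g)" by simp
  \<comment> \<open>Writing \<open>b\<close> for the square norm of \<open>hop f\<close> and
    \<open>m\<close> for that of \<open>f\<close>, the two upper bounds turn the inequality into
    \<open>0 \<le> 6 m - b / 3 + b / 6\<close>.\<close>
  with inner_torus_hop_le[OF pg assms(2)] inner_torus_hop_le[OF assms] show ?thesis by linarith
qed

lemma inner_torus_hop_funpow_le:
  assumes "periodic L f" "L > 0"
  shows "inner_torus L ((hop ^^ n) f) ((hop ^^ n) f) \<le> 36 ^ n * inner_torus L f f"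
proof (induction n)
  case (Suc n)
  have "inner_torus L ((hop ^^ Suc n) f) ((hop ^^ Suc n) f) \<le> 36 * inner_torus L ((hop ^^ n) f) ((hop ^^ n) f)"
    using inner_torus_hop_hop_le[OF periodic_hop_funpow[OF assms(1)] assms(2)] by simp
  then show ?case using Suc by simp
qed simp

lemma norm_le_inner_torus:
  assumes "periodic L f" "L > 0"
  shows "(norm (f r))\<^sup>2 \<le> inner_torus L f f"
proof -
  have "f (reduce L r) \<bullet> f (reduce L r) \<le> inner_torus L f f"
    unfolding inner_torus_def by (rule member_le_sum) (auto intro: reduce_in_cell assms)
  then show ?thesis using assms(1) by (simp only: periodicD power2_norm_eq_inner)
qed

section \<open>Point sources and finite propagation speed\<close>

lemma inner_torus_delta:
  assumes "periodic L g" "L > 0"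
  shows "inner_torus L (delta L r\<^sub>0 w) g = w \<bullet> g r\<^sub>0"
proof -
  have p: "periodic L (\<lambda>r. delta L r\<^sub>0 w r \<bullet> g r)"
    using assms(1) periodic_delta[of L r\<^sub>0 w] by (simp add: periodic_def)
  \<comment> \<open>Recentring at the source leaves the origin as the only point of the cell that
    contributes; the source itself need not lie in the cell.\<close>
  have "inner_torus L (delta L r\<^sub>0 w) g = (\<Sum>r\<in>cell L. delta L r\<^sub>0 w (r + r\<^sub>0) \<bullet> g (r + r\<^sub>0))"
    unfolding inner_torus_def using sum_cell_shift[OF p assms(2), of r\<^sub>0] by simp
  also have "\<dots> = (\<Sum>r\<in>cell L. if r = 0 then w \<bullet> g r\<^sub>0 else 0)"
    by (intro sum.cong) (auto simp: delta_def reduce_id)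
  also have "\<dots> = w \<bullet> g r\<^sub>0"
    using assms(2) by (simp add: sum.delta) (simp add: cell_def zero_prod_def)
  finally show ?thesis .
qed

lemma hop_translate: "hop (\<lambda>r. f (r - r\<^sub>0)) = (\<lambda>r. hop f (r - r\<^sub>0))"
  by (rule ext) (simp add: hop_def stencil_def algebra_simps)

definition sup_abs :: "lattice_site \<Rightarrow> int" where
  "sup_abs r = (case r of (a, b, c) \<Rightarrow> max \<bar>a\<bar> (max \<bar>b\<bar> \<bar>c\<bar>))"

lemma sup_abs_unit:
  "sup_abs (r + unit_x) \<le> sup_abs r + 1" "sup_abs (r + unit_y) \<le> sup_abs r + 1" "sup_abs (r + unit_z) \<le> sup_abs r + 1"
  "sup_abs (r - unit_x) \<le> sup_abs r + 1" "sup_abs (r - unit_y) \<le> sup_abs r + 1" "sup_abs (r - unit_z) \<le> sup_abs r + 1"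
  by (cases r; auto simp: sup_abs_def unit_x_def unit_y_def unit_z_def)+

lemma hop_local:
  assumes "\<And>s. sup_abs s \<le> sup_abs r + 1 \<Longrightarrow> f s = g s"
  shows "hop f r = hop g r"
  using assms[of r] assms[OF sup_abs_unit(1)] assms[OF sup_abs_unit(2)] assms[OF sup_abs_unit(3)]
    assms[OF sup_abs_unit(4)] assms[OF sup_abs_unit(5)] assms[OF sup_abs_unit(6)]
  by (simp add: hop_def stencil_def)

text \<open>Finite propagation speed: each application of \<open>hop\<close> looks one step further
  in the sup norm.\<close>

lemma hop_funpow_local:
  assumes "\<And>s. sup_abs s \<le> R \<Longrightarrow> f s = g s" "sup_abs r + int n \<le> R"
  shows "(hop ^^ n) f r = (hop ^^ n) g r"
  using assms(2)
proof (induction n arbitrary: r)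
  case 0
  then show ?case using assms(1) by simp
next
  case (Suc n)
  show ?case
    unfolding funpow.simps o_apply
    by (rule hop_local) (use Suc in auto)
qed

text \<open>Inside the box of sup radius \<open>L - 1\<close> the periodic source has no image
  besides the origin, and \<open>n\<close> hops from \<open>r\<close> do not leave that box.\<close>

lemma hop_kernel_stable:
  assumes "sup_abs r + int n < int L"
  shows "hop_kernel n L w r = hop_kernel n 0 w r"
  unfolding hop_kernel_def
proof (rule hop_funpow_local[where R = "int L - 1"])
  fix s assume s: "sup_abs s \<le> int L - 1"
  have *: "(a::int) mod int L = 0 \<longleftrightarrow> a = 0" if "\<bar>a\<bar> < int L" for a
    using that by (metis dvd_imp_le_int mod_0 mod_0_imp_dvd nat_int not_less abs_of_nat)
  show "delta L 0 w s = delta 0 0 w s"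
    using s by (cases s) (auto simp: sup_abs_def delta_def reduce_def zero_prod_def *)
qed (use assms in simp)

lemma hop_kernel_support:
  assumes "sup_abs r > int n"
  shows "hop_kernel n 0 w r = 0"
  using assms
proof (induction n arbitrary: r)
  case 0
  then show ?case by (cases r) (auto simp: hop_kernel_def delta_def sup_abs_def zero_prod_def)
next
  case (Suc n)
  have z: "hop_kernel n 0 w s = 0" if "sup_abs r \<le> sup_abs s + 1" for s
    using that Suc by auto
  have "hop_kernel (Suc n) 0 w r = hop (hop_kernel n 0 w) r" by (simp add: hop_kernel_def)
  \<comment> \<open>The instances of \<open>sup_abs_unit\<close> are read at the neighbours of
    \<open>r\<close>: stepping back to \<open>r\<close> raises \<open>sup_abs\<close> by at most
    one, which is the premise of \<open>z\<close>.\<close>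
  also have "\<dots> = 0"
    using z[of r] z[of "r + unit_x"] z[of "r + unit_y"] z[of "r + unit_z"] z[of "r - unit_x"] z[of "r - unit_y"] z[of "r - unit_z"]
      sup_abs_unit(1)[of "r - unit_x"] sup_abs_unit(2)[of "r - unit_y"] sup_abs_unit(3)[of "r - unit_z"]
      sup_abs_unit(4)[of "r + unit_x"] sup_abs_unit(5)[of "r + unit_y"] sup_abs_unit(6)[of "r + unit_z"]
    by (simp add: hop_def stencil_def)
  finally show ?case .
qed

text \<open>On a torus this is the operator bound applied to a point source. On the infinite lattice
  the value at \<open>r\<close> is that of a torus large enough not to be noticed after
  \<open>n\<close> hops, so no square-summable theory enters.\<close>

lemma norm_hop_kernel_le: "norm (hop_kernel n L w r) \<le> 6 ^ n * norm w"
proof -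
  have *: "norm (hop_kernel n L w r) \<le> 6 ^ n * norm w" if "L > 0" for L
  proof -
    have "(norm (hop_kernel n L w r))\<^sup>2 \<le> inner_torus L (hop_kernel n L w) (hop_kernel n L w)"
      by (rule norm_le_inner_torus) (use that in auto)
    also have "\<dots> \<le> 36 ^ n * inner_torus L (delta L 0 w) (delta L 0 w)"
      unfolding hop_kernel_def by (rule inner_torus_hop_funpow_le) (use that in auto)
    also have "inner_torus L (delta L 0 w) (delta L 0 w) = (norm w)\<^sup>2"
      using that by (simp add: inner_torus_delta delta_def power2_norm_eq_inner)
    also have "36 ^ n * (norm w)\<^sup>2 = (6 ^ n * norm w)\<^sup>2"
    proof -
      have "(36::real) ^ n = (6 ^ n)\<^sup>2"
        by (simp add: power2_eq_square flip: power_mult_distrib)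
      then show ?thesis by (simp add: power_mult_distrib)
    qed
    finally show ?thesis by (rule power2_le_imp_le) simp
  qed
  show ?thesis
  proof (cases "L = 0")
    case True
    have "hop_kernel n 0 w r = hop_kernel n (nat (sup_abs r + int n + 1)) w r"
      by (rule hop_kernel_stable[symmetric]) auto
    moreover have "sup_abs r \<ge> 0" by (auto simp: sup_abs_def split: prod.splits)
    ultimately show ?thesis using *[of "nat (sup_abs r + int n + 1)"] True by simp
  qed (use * in auto)
qed

section \<open>Moments: traces of diagonal blocks of powers of \<open>hop\<close>\<close>

definition moment :: "nat \<Rightarrow> nat \<Rightarrow> real" where
  "moment L n = hop_kernel n L (1, 0) 0 \<bullet> (1, 0) + hop_kernel n L (0, 1) 0 \<bullet> (0, 1)"

text \<open>Self-adjointness splits the power evenly between the two sources: an even power gives a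
  square norm, an odd one the nonnegative form of \<open>hop\<close> at
  \<open>(hop ^^ k) ?d\<close>.\<close>

lemma hop_kernel_diag_nonneg:
  assumes "L > 0"
  shows "hop_kernel n L w 0 \<bullet> w \<ge> 0"
proof -
  let ?d = "delta L 0 w"
  have sym: "inner_torus L ?d ((hop ^^ (a + b)) ?d) = inner_torus L ((hop ^^ a) ?d) ((hop ^^ b) ?d)" for a b
  proof (induction a arbitrary: b)
    case (Suc a)
    have "inner_torus L ?d ((hop ^^ (Suc a + b)) ?d) = inner_torus L ((hop ^^ a) ?d) ((hop ^^ (Suc b)) ?d)"
      using Suc[of "Suc b"] by simp
    also have "\<dots> = inner_torus L ((hop ^^ a) ?d) (hop ((hop ^^ b) ?d))" by simp
    also have "\<dots> = inner_torus L (hop ((hop ^^ a) ?d)) ((hop ^^ b) ?d)"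
      by (rule inner_torus_hop_sym) (use assms in \<open>auto intro: periodic_hop_funpow\<close>)
    finally show ?case by simp
  qed simp
  have "hop_kernel n L w 0 \<bullet> w = inner_torus L ?d ((hop ^^ n) ?d)"
    unfolding hop_kernel_def using assms by (simp add: inner_torus_delta periodic_hop_funpow inner_commute)
  also have "\<dots> \<ge> 0"
  proof (cases "even n")
    case True
    then obtain k where "n = k + k" by (metis evenE mult_2)
    then show ?thesis by (simp only: sym) (rule inner_torus_nonneg)
  next
    case False
    then obtain k where "n = k + Suc k" by (metis oddE add_Suc_right mult_2 Suc_eq_plus1)
    then show ?thesis
      by (simp only: sym) (simp add: inner_torus_hop_nonneg assms periodic_hop_funpow)
  qed
  finally show ?thesis by simp
qed

lemma moment_stable: "n < L \<Longrightarrow> moment L n = moment 0 n"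
  by (simp add: moment_def hop_kernel_stable sup_abs_def zero_prod_def)

lemma moment_nonneg: "moment L n \<ge> 0"
proof -
  have *: "moment L n \<ge> 0" if "L > 0" for L
    using that by (simp add: moment_def hop_kernel_diag_nonneg del: inner_Pair)
  show ?thesis
    using *[of L] *[of "Suc n"] moment_stable[of n "Suc n"] by (cases "L = 0") auto
qed

lemma moment_le: "moment L n \<le> 2 * 6 ^ n"
proof -
  have "hop_kernel n L w 0 \<bullet> w \<le> 6 ^ n" if "norm w = 1" for w
    using norm_cauchy_schwarz[of "hop_kernel n L w 0" w] norm_hop_kernel_le[of n L w 0] that by simp
  from this[of "(1,0)"] this[of "(0,1)"] show ?thesis
    by (simp add: moment_def norm_Pair)
qed

lemma moment_0 [simp]: "moment L 0 = 2"
  by (simp add: moment_def hop_kernel_def delta_def)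

section \<open>Second moments of Gaussian weights\<close>

text \<open>Checked on boxes, where the measure factors and each \<open>lborel\<close> is
  translation invariant. This is the change of variables that completes the square.\<close>

lemma distr_PiM_lborel_translate:
  fixes f :: "'i \<Rightarrow> 'a::euclidean_space"
  assumes I: "finite I"
  shows "distr (PiM I (\<lambda>_. lborel)) (PiM I (\<lambda>_. lborel)) (\<lambda>S. \<lambda>i\<in>I. S i + f i) = PiM I (\<lambda>_. lborel :: 'a measure)"
proof -
  interpret product_sigma_finite "\<lambda>_::'i. lborel :: 'a measure" by standard
  have meas: "(\<lambda>S. \<lambda>i\<in>I. S i + f i) \<in> measurable (PiM I (\<lambda>_. lborel)) (PiM I (\<lambda>_. lborel))"
    by (intro measurable_restrict) measurable
  show ?thesis
  proof (rule PiM_eqI[OF I])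
    fix A :: "'i \<Rightarrow> 'a set" assume A: "\<And>i. i \<in> I \<Longrightarrow> A i \<in> sets lborel"
    have shift: "emeasure lborel ((+) (f i) -` A i) = emeasure lborel (A i)" if "i \<in> I" for i
    proof -
      have "emeasure (distr lborel borel ((+) (f i))) (A i) = emeasure lborel ((+) (f i) -` A i \<inter> space lborel)"
        using A[OF that] by (intro emeasure_distr) auto
      then show ?thesis by (simp add: lborel_distr_plus)
    qed
    have sh: "(+) (f i) -` A i \<in> sets lborel" if "i \<in> I" for i
    proof -
      have "(+) (f i) -` A i \<inter> space (lborel :: 'a measure) \<in> sets lborel"
        using A[OF that] by (intro measurable_sets[of _ lborel lborel]) auto
      then show ?thesis by simp
    qed
    have "emeasure (distr (PiM I (\<lambda>_. lborel)) (PiM I (\<lambda>_. lborel)) (\<lambda>S. \<lambda>i\<in>I. S i + f i)) (Pi\<^sub>E I A)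
        = emeasure (PiM I (\<lambda>_. lborel)) ((\<lambda>S. \<lambda>i\<in>I. S i + f i) -` Pi\<^sub>E I A \<inter> space (PiM I (\<lambda>_. lborel)))"
      using A by (intro emeasure_distr meas sets_PiM_I_finite I)
    also have "(\<lambda>S. \<lambda>i\<in>I. S i + f i) -` Pi\<^sub>E I A \<inter> space (PiM I (\<lambda>_. lborel)) = Pi\<^sub>E I (\<lambda>i. (+) (f i) -` A i)"
      by (auto simp: space_PiM PiE_iff add.commute)
    also have "emeasure (PiM I (\<lambda>_. lborel)) \<dots> = (\<Prod>i\<in>I. emeasure lborel (A i))"
      using sh by (subst emeasure_PiM[OF I]) (auto simp: shift)
    finally show "emeasure (distr (PiM I (\<lambda>_. lborel)) (PiM I (\<lambda>_. lborel)) (\<lambda>S. \<lambda>i\<in>I. S i + f i)) (Pi\<^sub>E I A)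
      = (\<Prod>i\<in>I. emeasure lborel (A i))" .
  qed simp
qed

text \<open>A majorant uniform in \<open>s\<close>, needed for dominated convergence. The numerator
  is the square of twice the hyperbolic sine of \<open>s * \<bar>x\<bar> / 2\<close>, and the
  inequality \<open>tanh y \<le> y\<close> cancels the \<open>s\<close> in the denominator.\<close>

lemma cosh_quotient_bound:
  fixes x s :: real
  assumes "0 < s" "s \<le> 1"
  shows "\<bar>(exp (s * x) + exp (- s * x) - 2) / s\<^sup>2\<bar> \<le> exp (2 * x) + exp (- 2 * x)"
proof -
  \<comment> \<open>This is \<open>tanh y \<le> y\<close>, squared and cleared of
    denominators.\<close>
  have *: "(exp y - exp (- y))\<^sup>2 \<le> y\<^sup>2 * (exp y + exp (- y))\<^sup>2" if "y \<ge> 0" for y :: real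
  proof -
    have "exp y - exp (-y) \<le> y * (exp y + exp (-y))"
    proof -
      have "(1 - y) \<le> (1 + y) * exp (- 2 * y)"
      proof -
        let ?g = "\<lambda>y::real. (1 + y) * exp (- 2 * y) - (1 - y)"
        have "?g 0 \<le> ?g y"
        proof (rule DERIV_nonneg_imp_nondecreasing[OF that])
          fix t :: real assume t: "0 \<le> t" "t \<le> y"
          have "(?g has_real_derivative (1 - (1 + 2 * t) * exp (- 2 * t))) (at t)"
            by (auto intro!: derivative_eq_intros simp: algebra_simps)
          moreover have "(1 + 2 * t) * exp (- 2 * t) \<le> 1"
            using exp_ge_add_one_self[of "2*t"] by (simp add: exp_minus field_simps)
          ultimately show "\<exists>z. (?g has_real_derivative z) (at t) \<and> 0 \<le> z" by (intro exI conjI) auto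
        qed
        then show ?thesis by simp
      qed
      then have "(1 - y) * exp y \<le> (1 + y) * exp (- 2 * y) * exp y"
        by (intro mult_right_mono) auto
      also have "exp (- 2 * y) * exp y = exp (- y)" by (simp flip: exp_add)
      then have "(1 + y) * exp (- 2 * y) * exp y = (1 + y) * exp (- y)" by (simp add: mult.assoc)
      finally show ?thesis by (simp add: algebra_simps)
    qed
    moreover have "0 \<le> exp y - exp (-y)" using that by simp
    ultimately have "(exp y - exp (-y))\<^sup>2 \<le> (y * (exp y + exp (-y)))\<^sup>2" by (intro power_mono)
    then show ?thesis by (simp add: power_mult_distrib)
  qed
  define z where "z = \<bar>x\<bar> / 2"
  have z0: "z \<ge> 0" by (simp add: z_def)
  have e1: "exp (s * x) + exp (- s * x) - 2 = (exp (s * z) - exp (- (s * z)))\<^sup>2"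
  proof -
    have "(exp (s * z) - exp (- (s * z)))\<^sup>2 = exp (s * \<bar>x\<bar>) + exp (- (s * \<bar>x\<bar>)) - 2"
      by (simp add: power2_eq_square z_def algebra_simps flip: exp_add)
    then show ?thesis by (cases "x \<ge> 0") auto
  qed
  have "(exp (s * z) - exp (- (s * z)))\<^sup>2 / s\<^sup>2 \<le> z\<^sup>2 * (exp (s * z) + exp (- (s * z)))\<^sup>2"
    using *[of "s * z"] assms z0 by (simp add: field_simps power_mult_distrib)
  also have "\<dots> \<le> z\<^sup>2 * (2 * exp z)\<^sup>2"
  proof (intro mult_left_mono power_mono)
    have "s * z \<le> z" using assms z0 by (simp add: mult_left_le_one_le)
    moreover have "- (s * z) \<le> z" using mult_nonneg_nonneg[of s z] assms z0 by linarith
    ultimately have "exp (s * z) \<le> exp z" "exp (- (s * z)) \<le> exp z" by simp_all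
    then show "exp (s * z) + exp (- (s * z)) \<le> 2 * exp z" by linarith
  qed auto
  also have "\<dots> = (2 * z)\<^sup>2 * (exp z)\<^sup>2" by (simp add: power_mult_distrib)
  also have "\<dots> \<le> (exp z)\<^sup>2 * (exp (2 * z))"
  proof -
    \<comment> \<open>The first exponential is at least 2 and the second at least \<open>z\<close>;
      this absorbs the polynomial factor.\<close>
    have "2 * z \<le> exp 1 * exp (z - 1)"
      using exp_ge_add_one_self[of "z - 1"] exp_ge_add_one_self[of 1] z0 by (intro mult_mono) auto
    also have "\<dots> = exp z" by (simp flip: exp_add)
    finally have "2 * z \<le> exp z" .
    then have "(2 * z)\<^sup>2 \<le> (exp z)\<^sup>2" using z0 by (intro power_mono) auto
    then have "(2 * z)\<^sup>2 * (exp z)\<^sup>2 \<le> (exp z)\<^sup>2 * (exp z)\<^sup>2" by (intro mult_right_mono) auto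
    then show ?thesis by (simp only: exp_double)
  qed
  also have "\<dots> = exp (2 * \<bar>x\<bar>)" by (simp add: z_def flip: exp_double exp_add)
  also have "\<dots> \<le> exp (2 * x) + exp (- 2 * x)" by (cases "x \<ge> 0") auto
  finally show ?thesis unfolding e1 by simp
qed

lemma cosh_quotient_tendsto:
  fixes x :: real
  shows "(\<lambda>k. (exp (inverse (real (Suc k)) * x) + exp (- inverse (real (Suc k)) * x) - 2)
           / (inverse (real (Suc k)))\<^sup>2) \<longlonglongrightarrow> x\<^sup>2"
  unfolding power2_eq_square[of x] by real_asymp

text \<open>Translating the integration variable by \<open>- t f\<close> yields the moment generating function of \<open>l\<close>; the
  second moment is the limit of its symmetric second difference quotients at \<open>0\<close>.\<close>

lemma gaussian_second_moment:
  fixes f :: "'i \<Rightarrow> 'a::euclidean_space"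
  assumes I: "finite I"
    and [measurable]: "q \<in> borel_measurable (PiM I (\<lambda>_. lborel))" "l \<in> borel_measurable (PiM I (\<lambda>_. lborel))"
    and q: "\<And>S t. q (\<lambda>i\<in>I. S i + t *\<^sub>R f i) = q S + 2 * t * l S + t\<^sup>2 * c"
    and int: "integrable (PiM I (\<lambda>_. lborel)) (\<lambda>S. exp (- q S / 2))"
  shows "integrable (PiM I (\<lambda>_. lborel)) (\<lambda>S. (l S)\<^sup>2 * exp (- q S / 2))"
    and "(\<integral>S. (l S)\<^sup>2 * exp (- q S / 2) \<partial>(PiM I (\<lambda>_. lborel))) = c * (\<integral>S. exp (- q S / 2) \<partial>(PiM I (\<lambda>_. lborel)))"
proof -
  let ?M = "PiM I (\<lambda>_. lborel :: 'a measure)"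
  let ?Z = "\<integral>S. exp (- q S / 2) \<partial>?M"
  have mgf: "integrable ?M (\<lambda>S. exp (t * l S) * exp (- q S / 2)) \<and>
      (\<integral>S. exp (t * l S) * exp (- q S / 2) \<partial>?M) = exp (t\<^sup>2 * c / 2) * ?Z" for t
  proof -
    let ?T = "\<lambda>S. \<lambda>i\<in>I. S i + (- t) *\<^sub>R f i"
    have T [measurable]: "?T \<in> measurable ?M ?M"
      by (intro measurable_restrict) measurable
    have tr: "distr ?M ?M ?T = ?M"
      by (rule distr_PiM_lborel_translate[OF I])
    \<comment> \<open>Expanding \<open>q\<close> at the translated point produces the linear term
      \<open>t * l S\<close> in the exponent, at the cost of a constant factor.\<close>
    have eq: "exp (- q (?T S) / 2) = exp (- (t\<^sup>2 * c / 2)) * (exp (t * l S) * exp (- q S / 2))" for S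
      by (subst q) (simp add: field_simps flip: exp_add)
    have "integrable (distr ?M ?M ?T) (\<lambda>S. exp (- q S / 2))" using int tr by simp
    then have i1: "integrable ?M (\<lambda>S. exp (- q (?T S) / 2))"
      by (subst (asm) integrable_distr_eq) auto
    have "(\<integral>S. exp (- q S / 2) \<partial>distr ?M ?M ?T) = (\<integral>S. exp (- q (?T S) / 2) \<partial>?M)"
      by (rule integral_distr) auto
    then have i2: "?Z = (\<integral>S. exp (- q (?T S) / 2) \<partial>?M)" using tr by simp
    have i3: "integrable ?M (\<lambda>S. exp (t * l S) * exp (- q S / 2))"
      using i1 unfolding eq by simp
    moreover have "?Z = exp (- (t\<^sup>2 * c / 2)) * (\<integral>S. exp (t * l S) * exp (- q S / 2) \<partial>?M)"
      using i2 unfolding eq by simp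
    then have "exp (t\<^sup>2 * c / 2) * ?Z = (\<integral>S. exp (t * l S) * exp (- q S / 2) \<partial>?M)"
      by (simp add: exp_minus)
    ultimately show ?thesis by simp
  qed
  define s where "s k = inverse (real (Suc k))" for k
  have s: "0 < s k" "s k \<le> 1" for k by (auto simp: s_def field_simps)
  let ?u = "\<lambda>k S. (exp (s k * l S) + exp (- s k * l S) - 2) / (s k)\<^sup>2 * exp (- q S / 2)"
  \<comment> \<open>One majorant for all quotients; it is integrable because the moment generating
    function is finite at 2 and at -2.\<close>
  let ?w = "\<lambda>S. (exp (2 * l S) + exp (- 2 * l S)) * exp (- q S / 2)"
  have w: "integrable ?M ?w"
    using mgf[of 2] mgf[of "-2"] by (simp add: ring_distribs)
  have bd: "norm (?u k S) \<le> ?w S" for k S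
  proof -
    have "norm (?u k S) = \<bar>(exp (s k * l S) + exp (- s k * l S) - 2) / (s k)\<^sup>2\<bar> * exp (- q S / 2)"
      by (simp add: abs_mult)
    also have "\<dots> \<le> ?w S"
      by (intro mult_right_mono cosh_quotient_bound s) simp
    finally show ?thesis .
  qed
  have lim: "(\<lambda>k. ?u k S) \<longlonglongrightarrow> (l S)\<^sup>2 * exp (- q S / 2)" for S
    unfolding s_def by (intro tendsto_mult cosh_quotient_tendsto tendsto_const)
  show i: "integrable ?M (\<lambda>S. (l S)\<^sup>2 * exp (- q S / 2))"
    by (rule integrable_dominated_convergence[where s = ?u, OF _ _ w]) (use lim bd in auto)
  have c1: "(\<lambda>k. \<integral>S. ?u k S \<partial>?M) \<longlonglongrightarrow> (\<integral>S. (l S)\<^sup>2 * exp (- q S / 2) \<partial>?M)"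
    by (rule integral_dominated_convergence[OF _ _ w]) (use lim bd in auto)
  \<comment> \<open>The moment generating function is even in \<open>t\<close>, so both exponentials
    have the same integral.\<close>
  have ev: "(\<integral>S. ?u k S \<partial>?M) = (2 * exp ((s k)\<^sup>2 * c / 2) - 2) / (s k)\<^sup>2 * ?Z" for k
  proof -
    have "?u k = (\<lambda>S. (exp (s k * l S) * exp (- q S / 2) + exp (- s k * l S) * exp (- q S / 2) - 2 * exp (- q S / 2)) / (s k)\<^sup>2)"
      by (rule ext) (simp add: field_simps)
    then have "(\<integral>S. ?u k S \<partial>?M) = ((\<integral>S. exp (s k * l S) * exp (- q S / 2) \<partial>?M) + (\<integral>S. exp (- s k * l S) * exp (- q S / 2) \<partial>?M)
       - 2 * ?Z) / (s k)\<^sup>2"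
      using mgf[of "s k"] mgf[of "- s k"] int by simp
    also have "\<dots> = (2 * exp ((s k)\<^sup>2 * c / 2) - 2) / (s k)\<^sup>2 * ?Z"
      using mgf[of "s k"] mgf[of "- s k"] by (simp add: field_simps)
    finally show ?thesis .
  qed
  have "(\<lambda>k. (2 * exp ((s k)\<^sup>2 * c / 2) - 2) / (s k)\<^sup>2 * ?Z) \<longlonglongrightarrow> c * ?Z"
  proof (intro tendsto_mult tendsto_const)
    show "(\<lambda>k. (2 * exp ((s k)\<^sup>2 * c / 2) - 2) / (s k)\<^sup>2) \<longlonglongrightarrow> c"
      unfolding s_def by real_asymp
  qed
  with c1[unfolded ev] show "(\<integral>S. (l S)\<^sup>2 * exp (- q S / 2) \<partial>?M) = c * ?Z"
    by (rule LIMSEQ_unique)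
qed

text \<open>In each coordinate the weight is a multiple of the normal density of variance
  \<open>1 / t\<close>.\<close>

lemma gaussian_plane:
  fixes t :: real
  assumes "t > 0"
  shows "integrable lborel (\<lambda>x::real \<times> real. exp (- t * (x \<bullet> x) / 2))"
    and "(\<integral>x. exp (- t * (x \<bullet> x) / 2) \<partial>(lborel :: (real \<times> real) measure)) = 2 * pi / t"
proof -
  let ?g = "\<lambda>x::real. exp (- t * x\<^sup>2 / 2)"
  have g: "?g x = sqrt (2 * pi / t) * normal_density 0 (1 / sqrt t) x" for x
    using assms by (simp add: normal_density_def field_simps real_sqrt_divide real_sqrt_mult)
  have ig: "integrable lborel ?g" unfolding g using assms by simp
  have vg: "(\<integral>x. ?g x \<partial>lborel) = sqrt (2 * pi / t)" unfolding g using assms by simp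
  have e: "(\<lambda>x::real \<times> real. exp (- t * (x \<bullet> x) / 2)) = (\<lambda>(x, y). ?g x * ?g y)"
    by (auto simp: fun_eq_iff inner_prod_def power2_eq_square field_simps simp flip: exp_add)
  have iprod: "integrable (lborel \<Otimes>\<^sub>M lborel) (\<lambda>(x, y). ?g x * ?g y)"
    by (rule lborel_pair.Fubini_integrable) (use ig in auto)
  show "integrable lborel (\<lambda>x::real \<times> real. exp (- t * (x \<bullet> x) / 2))"
    unfolding e lborel_prod[symmetric] by (rule iprod)
  have "(\<integral>x. exp (- t * (x \<bullet> x) / 2) \<partial>(lborel :: (real \<times> real) measure)) = (\<integral>x. \<integral>y. ?g x * ?g y \<partial>lborel \<partial>lborel)"
    unfolding e lborel_prod[symmetric]
    using lborel_pair.integral_fst'[OF iprod] by (simp only: prod.case)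
  also have "\<dots> = sqrt (2 * pi / t) * sqrt (2 * pi / t)"
    using vg by simp
  also have "\<dots> = 2 * pi / t" using assms by simp
  finally show "(\<integral>x. exp (- t * (x \<bullet> x) / 2) \<partial>(lborel :: (real \<times> real) measure)) = 2 * pi / t" .
qed

section \<open>The Gaussian model on the torus\<close>

text \<open>Turns a torus configuration into a periodic lattice field, to which the operator
  identities apply.\<close>

definition lift_config :: "nat \<Rightarrow> config \<Rightarrow> lattice_field" where
  "lift_config L S r = S (site_of L r)"

definition embed_site :: "site \<Rightarrow> lattice_site" where
  "embed_site s = (case s of (x, y, z) \<Rightarrow> (int x, int y, int z))"

definition gauss_weight :: "real \<Rightarrow> real \<Rightarrow> nat \<Rightarrow> config \<Rightarrow> real" where
  "gauss_weight \<kappa> \<tau> L S = exp (- quad_form \<kappa> \<tau> L (lift_config L S) (lift_config L S) / 2)"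

definition gauss_partition :: "real \<Rightarrow> real \<Rightarrow> nat \<Rightarrow> real" where
  "gauss_partition \<kappa> \<tau> L = (\<integral>S. gauss_weight \<kappa> \<tau> L S \<partial>config_measure L)"

section \<open>Translation between \<open>sites\<close> and periodic fields\<close>

lemma finite_sites [simp]: "finite (sites L)"
  by (simp add: sites_def)

lemma card_sites: "card (sites L) = L ^ 3"
  by (simp add: sites_def card_cartesian_product power3_eq_cube)

lemma site_of_in: "L > 0 \<Longrightarrow> site_of L r \<in> sites L"
  by (cases r) (auto simp: site_of_def sites_def nat_less_iff)

lemma periodic_lift [simp]: "periodic L (lift_config L S)"
  by (auto simp: periodic_def lift_config_def site_of_def reduce_def split: prod.splits)

lemma embed_site_of: "L > 0 \<Longrightarrow> embed_site (site_of L r) = reduce L r"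
  by (cases r) (auto simp: embed_site_def site_of_def reduce_def)

lemma site_of_embed: "s \<in> sites L \<Longrightarrow> site_of L (embed_site s) = s"
  by (cases s) (auto simp: embed_site_def site_of_def sites_def)

lemma sum_cell_sites:
  assumes "L > 0"
  shows "(\<Sum>r\<in>cell L. h (site_of L r)) = (\<Sum>s\<in>sites L. h s)"
proof (rule sum.reindex_bij_witness[where i = embed_site and j = "site_of L"])
  fix a assume "a \<in> cell L"
  then show "embed_site (site_of L a) = a" using assms by (simp add: embed_site_of reduce_id)
next
  fix b assume "b \<in> sites L"
  then show "embed_site b \<in> cell L" by (cases b) (auto simp: embed_site_def sites_def cell_def)
qed (auto simp: site_of_embed site_of_in assms)

lemma nat_mod_Suc: "L > 0 \<Longrightarrow> nat ((a + 1) mod int L) = Suc (nat (a mod int L)) mod L"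
proof -
  assume L: "L > 0"
  have "int (Suc (nat (a mod int L)) mod L) = (a mod int L + 1) mod int L"
    using L by (simp add: zmod_int add.commute)
  also have "\<dots> = (a + 1) mod int L" by (simp add: mod_simps)
  finally show ?thesis by linarith
qed

lemma site_of_shift:
  assumes "L > 0"
  shows "site_of L (r + unit_x) = shift_x L (site_of L r)"
    "site_of L (r + unit_y) = shift_y L (site_of L r)"
    "site_of L (r + unit_z) = shift_z L (site_of L r)"
  using assms by (cases r; simp add: site_of_def unit_x_def unit_y_def unit_z_def shift_x_def shift_y_def shift_z_def nat_mod_Suc)+

lemma hamiltonian_eq:
  assumes "L > 0"
  shows "hamiltonian J L S = J / 2 * energy L (lift_config L S) (lift_config L S)"
  unfolding hamiltonian_def energy_def energy_dir_def lift_config_def site_of_shift[OF assms]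
    sum_cell_sites[OF assms, where h = "\<lambda>s. ((S s - S (shift_x L s)) \<bullet> vec_a) * ((S s - S (shift_x L s)) \<bullet> vec_a)"]
    sum_cell_sites[OF assms, where h = "\<lambda>s. ((S s - S (shift_y L s)) \<bullet> vec_b) * ((S s - S (shift_y L s)) \<bullet> vec_b)"]
    sum_cell_sites[OF assms, where h = "\<lambda>s. ((S s - S (shift_z L s)) \<bullet> vec_c) * ((S s - S (shift_z L s)) \<bullet> vec_c)"]
  by (simp add: sum.distrib power2_eq_square inner_diff_left)

lemma inner_torus_lift:
  assumes "L > 0"
  shows "inner_torus L (lift_config L S) (lift_config L S) = (\<Sum>s\<in>sites L. S s \<bullet> S s)"
  unfolding inner_torus_def lift_config_def using sum_cell_sites[OF assms, where h = "\<lambda>s. S s \<bullet> S s"] .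

lemma constraint_eq:
  assumes "L > 0"
  shows "constraint L S = inner_torus L (lift_config L S) (lift_config L S)"
  unfolding inner_torus_lift[OF assms] constraint_def
  by (simp add: inner_prod_def power2_eq_square)

lemma gibbs_weight_eq:
  assumes "L > 0"
  shows "gibbs_weight J L \<beta> \<mu> S = gauss_weight (\<beta> * J) (2 * \<mu>) L S"
  unfolding gibbs_weight_def gauss_weight_def quad_form_def hamiltonian_eq[OF assms] constraint_eq[OF assms]
  by (simp add: field_simps)

lemma partition_fn_eq: "L > 0 \<Longrightarrow> partition_fn J L \<beta> \<mu> = gauss_partition (\<beta> * J) (2 * \<mu>) L"
  by (simp add: partition_fn_def gauss_partition_def gibbs_weight_eq)

lemma measurable_lift [measurable]:
  assumes "L > 0"
  shows "(\<lambda>S. lift_config L S r) \<in> borel_measurable (config_measure L)"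
  unfolding lift_config_def config_measure_def
  using measurable_component_singleton[OF site_of_in[OF assms], where M = "\<lambda>_. lborel"] by simp

lemma measurable_quad_form_lift [measurable]:
  assumes [simp]: "L > 0"
  shows "(\<lambda>S. quad_form \<kappa> \<tau> L f (lift_config L S)) \<in> borel_measurable (config_measure L)"
    "(\<lambda>S. quad_form \<kappa> \<tau> L (lift_config L S) (lift_config L S)) \<in> borel_measurable (config_measure L)"
  unfolding quad_form_def energy_def energy_dir_def inner_torus_def by measurable

section \<open>Comparison with independent spins\<close>

lemma gaussian_sites:
  assumes "L > 0" "t > 0"
  shows "integrable (config_measure L) (\<lambda>S. exp (- t * inner_torus L (lift_config L S) (lift_config L S) / 2))"
    and "(\<integral>S. exp (- t * inner_torus L (lift_config L S) (lift_config L S) / 2) \<partial>config_measure L) = (2 * pi / t) ^ (L ^ 3)"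
proof -
  interpret product_sigma_finite "\<lambda>_::site. lborel :: (real \<times> real) measure" by standard
  have e: "exp (- t * inner_torus L (lift_config L S) (lift_config L S) / 2) = (\<Prod>s\<in>sites L. exp (- t * (S s \<bullet> S s) / 2))" for S
    unfolding inner_torus_lift[OF assms(1)] by (simp add: sum_distrib_left sum_divide_distrib sum_negf flip: exp_sum)
  show "integrable (config_measure L) (\<lambda>S. exp (- t * inner_torus L (lift_config L S) (lift_config L S) / 2))"
    unfolding e config_measure_def by (intro product_integrable_prod gaussian_plane assms) simp
  show "(\<integral>S. exp (- t * inner_torus L (lift_config L S) (lift_config L S) / 2) \<partial>config_measure L) = (2 * pi / t) ^ (L ^ 3)"
    unfolding e config_measure_def
    by (subst product_integral_prod) (use gaussian_plane[OF assms(2)] in \<open>auto simp: card_sites\<close>)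
qed

lemma measurable_gauss_weight [measurable]: "L > 0 \<Longrightarrow> gauss_weight \<kappa> \<tau> L \<in> borel_measurable (config_measure L)"
  unfolding gauss_weight_def[abs_def] by measurable

lemma energy_le:
  assumes "periodic L f" "L > 0"
  shows "energy L f f \<le> 6 * inner_torus L f f"
  using energy_hop[OF assms(1,1,2)] inner_torus_hop_nonneg[OF assms] by linarith

text \<open>From \<open>0 \<le> energy \<le> 6\<close>: the weight lies between two products of
  one-site Gaussians. This serves integrability, positivity of the partition function and its
  asymptotics for large \<open>\<tau>\<close>.\<close>

lemma gauss_weight_bounds:
  assumes "L > 0" "\<kappa> > 0"
  shows "gauss_weight \<kappa> \<tau> L S \<le> exp (- \<tau> * inner_torus L (lift_config L S) (lift_config L S) / 2)"
    "exp (- (6 * \<kappa> + \<tau>) * inner_torus L (lift_config L S) (lift_config L S) / 2) \<le> gauss_weight \<kappa> \<tau> L S"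
proof -
  have "\<kappa> * energy L (lift_config L S) (lift_config L S) \<le> \<kappa> * (6 * inner_torus L (lift_config L S) (lift_config L S))"
    using assms by (intro mult_left_mono energy_le) auto
  moreover have "0 \<le> \<kappa> * energy L (lift_config L S) (lift_config L S)"
    using assms energy_nonneg by simp
  ultimately show "gauss_weight \<kappa> \<tau> L S \<le> exp (- \<tau> * inner_torus L (lift_config L S) (lift_config L S) / 2)"
    "exp (- (6 * \<kappa> + \<tau>) * inner_torus L (lift_config L S) (lift_config L S) / 2) \<le> gauss_weight \<kappa> \<tau> L S"
    unfolding gauss_weight_def quad_form_def exp_le_cancel_iff by (simp_all add: distrib_right left_diff_distrib)
qed

lemma integrable_gauss_weight:
  assumes "L > 0" "\<kappa> > 0" "\<tau> > 0"
  shows "integrable (config_measure L) (gauss_weight \<kappa> \<tau> L)"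
proof (rule Bochner_Integration.integrable_bound[OF gaussian_sites(1)[OF assms(1,3)]])
  show "AE S in config_measure L. norm (gauss_weight \<kappa> \<tau> L S) \<le> norm (exp (- \<tau> * inner_torus L (lift_config L S) (lift_config L S) / 2))"
    using gauss_weight_bounds(1)[OF assms(1,2)] by (auto simp: gauss_weight_def)
qed (use assms in simp)

lemma gauss_partition_bounds:
  assumes "L > 0" "\<kappa> > 0" "\<tau> > 0"
  shows "(2 * pi / (6 * \<kappa> + \<tau>)) ^ (L ^ 3) \<le> gauss_partition \<kappa> \<tau> L" "gauss_partition \<kappa> \<tau> L \<le> (2 * pi / \<tau>) ^ (L ^ 3)"
proof -
  have T: "6 * \<kappa> + \<tau> > 0" using assms by simp
  show "(2 * pi / (6 * \<kappa> + \<tau>)) ^ (L ^ 3) \<le> gauss_partition \<kappa> \<tau> L"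
    unfolding gaussian_sites(2)[OF assms(1) T, symmetric] gauss_partition_def
    using assms T by (intro integral_mono gaussian_sites(1) integrable_gauss_weight gauss_weight_bounds)
  show "gauss_partition \<kappa> \<tau> L \<le> (2 * pi / \<tau>) ^ (L ^ 3)"
    unfolding gaussian_sites(2)[OF assms(1,3), symmetric] gauss_partition_def
    using assms by (intro integral_mono gaussian_sites(1) integrable_gauss_weight gauss_weight_bounds)
qed

lemma gauss_partition_pos:
  assumes "L > 0" "\<kappa> > 0" "\<tau> > 0"
  shows "gauss_partition \<kappa> \<tau> L > 0"
proof -
  have "0 < (2 * pi / (6 * \<kappa> + \<tau>)) ^ (L ^ 3)" using assms by simp
  then show ?thesis using gauss_partition_bounds(1)[OF assms] by linarith
qed

section \<open>The covariance as a resolvent\<close>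

text \<open>\<open>gaussian_second_moment\<close> for translations along \<open>f\<close>, with
  \<open>Q(f, S)\<close> as the linear functional and \<open>Q(f, f)\<close> as the
  constant.\<close>

lemma quad_form_second_moment:
  assumes "L > 0" "\<kappa> > 0" "\<tau> > 0" "periodic L f"
  shows "integrable (config_measure L) (\<lambda>S. (quad_form \<kappa> \<tau> L f (lift_config L S))\<^sup>2 * gauss_weight \<kappa> \<tau> L S)"
    and "(\<integral>S. (quad_form \<kappa> \<tau> L f (lift_config L S))\<^sup>2 * gauss_weight \<kappa> \<tau> L S \<partial>config_measure L) = quad_form \<kappa> \<tau> L f f * gauss_partition \<kappa> \<tau> L"
proof -
  have q: "quad_form \<kappa> \<tau> L (lift_config L (\<lambda>s\<in>sites L. S s + t *\<^sub>R f (embed_site s))) (lift_config L (\<lambda>s\<in>sites L. S s + t *\<^sub>R f (embed_site s)))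
    = quad_form \<kappa> \<tau> L (lift_config L S) (lift_config L S) + 2 * t * quad_form \<kappa> \<tau> L f (lift_config L S) + t\<^sup>2 * quad_form \<kappa> \<tau> L f f" for S t
  proof -
    \<comment> \<open>Since \<open>f\<close> is periodic, shifting the finitely many spins shifts
      the whole lifted field by \<open>t\<close> times \<open>f\<close>.\<close>
    have "lift_config L (\<lambda>s\<in>sites L. S s + t *\<^sub>R f (embed_site s)) = (\<lambda>r. lift_config L S r + t *\<^sub>R f r)"
      using assms(1) by (intro ext) (simp add: lift_config_def site_of_in embed_site_of periodicD[OF assms(4)])
    then show ?thesis
      by (simp only: quad_form_lin_left quad_form_lin_right quad_form_sym[of \<kappa> \<tau> L f "lift_config L S"])
         (simp add: power2_eq_square algebra_simps)
  qed
  note * = gaussian_second_moment[OF finite_sites[of L], where f = "\<lambda>s. f (embed_site s)" and c = "quad_form \<kappa> \<tau> L f f",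
      OF _ _ q, folded config_measure_def gauss_weight_def,
      OF measurable_quad_form_lift(2)[OF assms(1)] measurable_quad_form_lift(1)[OF assms(1)] integrable_gauss_weight[OF assms(1-3)]]
  show "integrable (config_measure L) (\<lambda>S. (quad_form \<kappa> \<tau> L f (lift_config L S))\<^sup>2 * gauss_weight \<kappa> \<tau> L S)"
    by (rule *(1))
  show "(\<integral>S. (quad_form \<kappa> \<tau> L f (lift_config L S))\<^sup>2 * gauss_weight \<kappa> \<tau> L S \<partial>config_measure L) = quad_form \<kappa> \<tau> L f f * gauss_partition \<kappa> \<tau> L"
    unfolding gauss_partition_def by (rule *(2))
qed

text \<open>The Neumann series of \<open>(6 \<kappa> + \<tau> - \<kappa> hop)^(-1)\<close>, applied to a point source at \<open>r\<^sub>0\<close>.\<close>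

definition resolvent :: "real \<Rightarrow> real \<Rightarrow> nat \<Rightarrow> lattice_site \<Rightarrow> real \<times> real \<Rightarrow> lattice_field" where
  "resolvent \<kappa> \<tau> L r\<^sub>0 w r = (\<Sum>n. (\<kappa> ^ n / (6 * \<kappa> + \<tau>) ^ Suc n) *\<^sub>R hop_kernel n L w (r - r\<^sub>0))"

lemma summable_geom_bound:
  fixes \<kappa> \<tau> :: real
  assumes "\<kappa> > 0" "\<tau> > 0"
  shows "summable (\<lambda>n. \<kappa> ^ n / (6 * \<kappa> + \<tau>) ^ Suc n * 6 ^ n)"
proof -
  have "summable (\<lambda>n. (6 * \<kappa> / (6 * \<kappa> + \<tau>)) ^ n * (1 / (6 * \<kappa> + \<tau>)))"
    using assms by (intro summable_mult2 summable_geometric) (auto simp: field_simps)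
  then show ?thesis
    by (simp add: power_divide power_mult_distrib mult.commute)
qed

lemma summable_resolvent:
  assumes "\<kappa> > 0" "\<tau> > 0"
  shows "summable (\<lambda>n. (\<kappa> ^ n / (6 * \<kappa> + \<tau>) ^ Suc n) *\<^sub>R hop_kernel n L w r)"
proof (rule summable_comparison_test[OF _ summable_mult2[OF summable_geom_bound[OF assms], of "norm w"]])
  show "\<exists>N. \<forall>n\<ge>N. norm ((\<kappa> ^ n / (6 * \<kappa> + \<tau>) ^ Suc n) *\<^sub>R hop_kernel n L w r) \<le> \<kappa> ^ n / (6 * \<kappa> + \<tau>) ^ Suc n * 6 ^ n * norm w"
  proof (intro exI allI impI)
    fix n
    have "\<kappa> ^ n / (6 * \<kappa> + \<tau>) ^ Suc n * norm (hop_kernel n L w r) \<le> \<kappa> ^ n / (6 * \<kappa> + \<tau>) ^ Suc n * (6 ^ n * norm w)"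
      using assms by (intro mult_left_mono norm_hop_kernel_le) auto
    then show "norm ((\<kappa> ^ n / (6 * \<kappa> + \<tau>) ^ Suc n) *\<^sub>R hop_kernel n L w r) \<le> \<kappa> ^ n / (6 * \<kappa> + \<tau>) ^ Suc n * 6 ^ n * norm w"
      using assms by (simp add: mult.assoc abs_of_pos)
  qed
qed

lemma periodic_resolvent [simp]: "periodic L (resolvent \<kappa> \<tau> L r\<^sub>0 w)"
proof -
  have "periodic L (\<lambda>r. hop_kernel n L w (r - r\<^sub>0))" for n
    by (rule periodic_shift_diff) simp
  from periodicD[OF this] show ?thesis
    unfolding periodic_def resolvent_def by simp
qed

lemma stencil_sums:
  assumes "\<And>r. (\<lambda>n. s n r) sums f r"
  shows "(\<lambda>n. stencil e v (s n) r) sums stencil e v f r"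
proof -
  have "(\<lambda>n. 2 *\<^sub>R s n r + s n (r + e) + s n (r - e)) sums (2 *\<^sub>R f r + f (r + e) + f (r - e))"
    by (intro sums_add assms sums_scaleR_right)
  from bounded_linear.sums[OF bounded_linear_inner_left this]
  show ?thesis unfolding stencil_def by (intro sums_scaleR_left)
qed

lemma hop_sums:
  assumes "\<And>r. (\<lambda>n. s n r) sums f r"
  shows "(\<lambda>n. hop (s n) r) sums hop f r"
  unfolding hop_def by (intro sums_add stencil_sums assms)

lemma hop_scaleR: "hop (\<lambda>r. c *\<^sub>R f r) = (\<lambda>r. c *\<^sub>R hop f r)"
  by (rule ext) (simp add: hop_def stencil_def inner_simps algebra_simps)

text \<open>Applying \<open>\<kappa> hop\<close> to a term gives
  \<open>6 * \<kappa> + \<tau>\<close> times the next one, so the series telescopes down to its term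
  at index 0, the source.\<close>

lemma resolvent_equation:
  assumes "\<kappa> > 0" "\<tau> > 0"
  shows "(6 * \<kappa> + \<tau>) *\<^sub>R resolvent \<kappa> \<tau> L r\<^sub>0 w r - \<kappa> *\<^sub>R hop (resolvent \<kappa> \<tau> L r\<^sub>0 w) r = delta L r\<^sub>0 w r"
proof -
  let ?T = "6 * \<kappa> + \<tau>"
  have T: "?T > 0" using assms by simp
  define s where "s n r = (\<kappa> ^ n / ?T ^ Suc n) *\<^sub>R hop_kernel n L w (r - r\<^sub>0)" for n r
  have s: "(\<lambda>n. s n r) sums resolvent \<kappa> \<tau> L r\<^sub>0 w r" for r
    unfolding s_def resolvent_def by (rule summable_sums[OF summable_resolvent[OF assms]])
  have Bs: "\<kappa> *\<^sub>R hop (s n) r = ?T *\<^sub>R s (Suc n) r" for n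
  proof -
    have "hop (s n) r = (\<kappa> ^ n / ?T ^ Suc n) *\<^sub>R hop_kernel (Suc n) L w (r - r\<^sub>0)"
      unfolding s_def[abs_def] hop_scaleR hop_translate by (simp add: hop_kernel_def)
    then show ?thesis using T by (simp add: s_def)
  qed
  have "(\<lambda>n. ?T *\<^sub>R s (Suc n) r) sums (\<kappa> *\<^sub>R hop (resolvent \<kappa> \<tau> L r\<^sub>0 w) r)"
    unfolding Bs[symmetric] by (intro sums_scaleR_right hop_sums s)
  from sums_Suc[OF this]
  have "(\<lambda>n. ?T *\<^sub>R s n r) sums (\<kappa> *\<^sub>R hop (resolvent \<kappa> \<tau> L r\<^sub>0 w) r + ?T *\<^sub>R s 0 r)" .
  moreover have "(\<lambda>n. ?T *\<^sub>R s n r) sums (?T *\<^sub>R resolvent \<kappa> \<tau> L r\<^sub>0 w r)"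
    by (intro sums_scaleR_right s)
  ultimately have "?T *\<^sub>R resolvent \<kappa> \<tau> L r\<^sub>0 w r = \<kappa> *\<^sub>R hop (resolvent \<kappa> \<tau> L r\<^sub>0 w) r + ?T *\<^sub>R s 0 r"
    using sums_unique2 by blast
  moreover have "?T *\<^sub>R s 0 r = delta L r\<^sub>0 w r"
    using T by (simp add: s_def hop_kernel_def delta_def)
  ultimately show ?thesis by simp
qed

text \<open>The reproducing property: in the form \<open>Q\<close>, the resolvent represents
  evaluation at \<open>r\<^sub>0\<close> in the direction \<open>w\<close>.\<close>

lemma quad_form_resolvent:
  assumes "L > 0" "\<kappa> > 0" "\<tau> > 0" "periodic L g"
  shows "quad_form \<kappa> \<tau> L g (resolvent \<kappa> \<tau> L r\<^sub>0 w) = g r\<^sub>0 \<bullet> w"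
proof -
  let ?R = "resolvent \<kappa> \<tau> L r\<^sub>0 w"
  have "quad_form \<kappa> \<tau> L g ?R = inner_torus L g (\<lambda>r. (6 * \<kappa> + \<tau>) *\<^sub>R ?R r - \<kappa> *\<^sub>R hop ?R r)"
    unfolding quad_form_eq_inner_torus[OF assms(4) periodic_resolvent assms(1)]
    by (simp add: inner_torus_def inner_simps sum_subtractf sum_distrib_left)
  also have "\<dots> = inner_torus L g (delta L r\<^sub>0 w)"
    unfolding resolvent_equation[OF assms(2,3)] ..
  also have "\<dots> = g r\<^sub>0 \<bullet> w"
    by (subst inner_torus_sym) (simp add: inner_torus_delta assms inner_commute)
  finally show ?thesis .
qed

text \<open>The reproducing property writes each spin component as \<open>Q(f, S)\<close>.
  Polarising the second moments gives \<open>Q(f0, f1)\<close>, which the same property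
  evaluates.\<close>

lemma covariance:
  assumes "L > 0" "\<kappa> > 0" "\<tau> > 0"
  shows "integrable (config_measure L) (\<lambda>S. (lift_config L S r\<^sub>0 \<bullet> w\<^sub>0) * (lift_config L S r\<^sub>1 \<bullet> w\<^sub>1) * gauss_weight \<kappa> \<tau> L S)" (is ?A)
    and "(\<integral>S. (lift_config L S r\<^sub>0 \<bullet> w\<^sub>0) * (lift_config L S r\<^sub>1 \<bullet> w\<^sub>1) * gauss_weight \<kappa> \<tau> L S \<partial>config_measure L)
       = (resolvent \<kappa> \<tau> L r\<^sub>1 w\<^sub>1 r\<^sub>0 \<bullet> w\<^sub>0) * gauss_partition \<kappa> \<tau> L" (is ?B)
proof -
  let ?f0 = "resolvent \<kappa> \<tau> L r\<^sub>0 w\<^sub>0" and ?f1 = "resolvent \<kappa> \<tau> L r\<^sub>1 w\<^sub>1"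
  let ?Q = "quad_form \<kappa> \<tau> L"
  define g where "g s r = ?f0 r + s *\<^sub>R ?f1 r" for s r
  have pg: "periodic L (g s)" for s
    using periodic_resolvent[of L \<kappa> \<tau> r\<^sub>0 w\<^sub>0] periodic_resolvent[of L \<kappa> \<tau> r\<^sub>1 w\<^sub>1]
    unfolding periodic_def g_def by metis
  have Qg: "?Q (g s) (lift_config L S) = lift_config L S r\<^sub>0 \<bullet> w\<^sub>0 + s * (lift_config L S r\<^sub>1 \<bullet> w\<^sub>1)" for s S
    unfolding g_def quad_form_lin_left
    by (subst (1 2) quad_form_sym) (simp add: quad_form_resolvent assms)
  have Qgg: "?Q (g s) (g s) = ?Q ?f0 ?f0 + 2 * s * ?Q ?f0 ?f1 + s\<^sup>2 * ?Q ?f1 ?f1" for s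
    unfolding g_def quad_form_lin_left quad_form_lin_right using quad_form_sym[of \<kappa> \<tau> L ?f1 ?f0]
    by (simp add: algebra_simps power2_eq_square)
  have Q01: "?Q ?f0 ?f1 = ?f1 r\<^sub>0 \<bullet> w\<^sub>0"
    by (subst quad_form_sym) (simp add: quad_form_resolvent assms)
  note m = quad_form_second_moment[OF assms pg]
  \<comment> \<open>The product \<open>x y\<close> is a quarter of
    \<open>(x + y)^2 - (x - y)^2\<close>; the two squares belong to \<open>g 1\<close> and
    \<open>g (-1)\<close>.\<close>
  have e: "(lift_config L S r\<^sub>0 \<bullet> w\<^sub>0) * (lift_config L S r\<^sub>1 \<bullet> w\<^sub>1) * gauss_weight \<kappa> \<tau> L S
     = ((?Q (g 1) (lift_config L S))\<^sup>2 * gauss_weight \<kappa> \<tau> L S - (?Q (g (-1)) (lift_config L S))\<^sup>2 * gauss_weight \<kappa> \<tau> L S) / 4" for S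
    unfolding Qg by (simp add: power2_eq_square algebra_simps)
  show ?A unfolding e by (intro integrable_divide Bochner_Integration.integrable_diff m)
  have "(\<integral>S. (lift_config L S r\<^sub>0 \<bullet> w\<^sub>0) * (lift_config L S r\<^sub>1 \<bullet> w\<^sub>1) * gauss_weight \<kappa> \<tau> L S \<partial>config_measure L)
     = (?Q (g 1) (g 1) * gauss_partition \<kappa> \<tau> L - ?Q (g (-1)) (g (-1)) * gauss_partition \<kappa> \<tau> L) / 4"
    unfolding e by (simp add: m)
  also have "\<dots> = (?f1 r\<^sub>0 \<bullet> w\<^sub>0) * gauss_partition \<kappa> \<tau> L"
    unfolding Qgg Q01 by (simp add: field_simps)
  finally show ?B .
qed

text \<open>The mean square length of a single spin, the same at every site; for
  \<open>L = 0\<close>, its value on the infinite lattice.\<close>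

definition mean_sq :: "real \<Rightarrow> real \<Rightarrow> nat \<Rightarrow> real" where
  "mean_sq \<kappa> \<tau> L = (\<Sum>n. \<kappa> ^ n / (6 * \<kappa> + \<tau>) ^ Suc n * moment L n)"

lemma resolvent_inner:
  assumes "\<kappa> > 0" "\<tau> > 0"
  shows "(\<lambda>n. \<kappa> ^ n / (6 * \<kappa> + \<tau>) ^ Suc n * (hop_kernel n L w\<^sub>1 (r\<^sub>0 - r\<^sub>1) \<bullet> w\<^sub>0)) sums (resolvent \<kappa> \<tau> L r\<^sub>1 w\<^sub>1 r\<^sub>0 \<bullet> w\<^sub>0)"
  using bounded_linear.sums[OF bounded_linear_inner_left summable_sums[OF summable_resolvent[OF assms, of L w\<^sub>1 "r\<^sub>0 - r\<^sub>1"]]]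
  by (simp add: resolvent_def)

lemma mean_sq_resolvent:
  assumes "\<kappa> > 0" "\<tau> > 0"
  shows "resolvent \<kappa> \<tau> L r (1, 0) r \<bullet> (1, 0) + resolvent \<kappa> \<tau> L r (0, 1) r \<bullet> (0, 1) = mean_sq \<kappa> \<tau> L"
proof -
  have "(\<lambda>n. \<kappa> ^ n / (6 * \<kappa> + \<tau>) ^ Suc n * moment L n) sums
      (resolvent \<kappa> \<tau> L r (1, 0) r \<bullet> (1, 0) + resolvent \<kappa> \<tau> L r (0, 1) r \<bullet> (0, 1))"
    using sums_add[OF resolvent_inner[OF assms, of L "(1,0)" r r "(1,0)"] resolvent_inner[OF assms, of L "(0,1)" r r "(0,1)"]]
    by (simp add: moment_def distrib_left del: inner_Pair)
  then show ?thesis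
    unfolding mean_sq_def by (rule sums_unique)
qed

lemma constraint_moment:
  assumes "L > 0" "\<kappa> > 0" "\<tau> > 0"
  shows "integrable (config_measure L) (\<lambda>S. constraint L S * gauss_weight \<kappa> \<tau> L S)"
    and "(\<integral>S. constraint L S * gauss_weight \<kappa> \<tau> L S \<partial>config_measure L) = real L ^ 3 * mean_sq \<kappa> \<tau> L * gauss_partition \<kappa> \<tau> L"
proof -
  let ?h = "\<lambda>w r S. (lift_config L S r \<bullet> w) * (lift_config L S r \<bullet> w) * gauss_weight \<kappa> \<tau> L S"
  have e: "constraint L S * gauss_weight \<kappa> \<tau> L S = (\<Sum>r\<in>cell L. ?h (1, 0) r S + ?h (0, 1) r S)" for S
    unfolding constraint_eq[OF assms(1)] inner_torus_def sum_distrib_right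
    by (intro sum.cong refl) (simp add: inner_prod_def algebra_simps)
  note c = covariance[OF assms]
  show "integrable (config_measure L) (\<lambda>S. constraint L S * gauss_weight \<kappa> \<tau> L S)"
    unfolding e by (intro Bochner_Integration.integrable_sum Bochner_Integration.integrable_add c)
  have "(\<integral>S. constraint L S * gauss_weight \<kappa> \<tau> L S \<partial>config_measure L)
    = (\<Sum>r\<in>cell L. (\<integral>S. ?h (1, 0) r S \<partial>config_measure L) + (\<integral>S. ?h (0, 1) r S \<partial>config_measure L))"
    unfolding e by (simp add: Bochner_Integration.integral_sum c del: inner_Pair)
  also have "\<dots> = (\<Sum>r\<in>cell L. mean_sq \<kappa> \<tau> L * gauss_partition \<kappa> \<tau> L)"
    unfolding c by (simp only: mean_sq_resolvent[OF assms(2,3)] distrib_right[symmetric])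
  finally show "(\<integral>S. constraint L S * gauss_weight \<kappa> \<tau> L S \<partial>config_measure L) = real L ^ 3 * mean_sq \<kappa> \<tau> L * gauss_partition \<kappa> \<tau> L"
    by (simp add: card_cell)
qed

text \<open>A constant field has no energy, so \<open>Q(w, S)\<close> is \<open>\<tau>\<close> times
  the component of the total spin along \<open>w\<close>; its variance is explicit and does not
  involve \<open>\<kappa>\<close>.\<close>

lemma total_spin_moment:
  assumes "L > 0" "\<kappa> > 0" "\<tau> > 0"
  shows "integrable (config_measure L) (\<lambda>S. ((\<Sum>s\<in>sites L. S s) \<bullet> w)\<^sup>2 * gauss_weight \<kappa> \<tau> L S)"
    and "(\<integral>S. ((\<Sum>s\<in>sites L. S s) \<bullet> w)\<^sup>2 * gauss_weight \<kappa> \<tau> L S \<partial>config_measure L) = real L ^ 3 * (w \<bullet> w) / \<tau> * gauss_partition \<kappa> \<tau> L"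
proof -
  let ?f = "\<lambda>_::lattice_site. w"
  have p: "periodic L ?f" by (simp add: periodic_def)
  have Q: "quad_form \<kappa> \<tau> L ?f g = \<tau> * inner_torus L ?f g" for g
    by (simp add: quad_form_def energy_def energy_dir_def)
  have s: "inner_torus L ?f (lift_config L S) = (\<Sum>s\<in>sites L. S s) \<bullet> w" for S
    unfolding inner_torus_def lift_config_def using sum_cell_sites[OF assms(1), of "\<lambda>s. w \<bullet> S s"]
    by (subst inner_commute) (simp add: inner_sum_right)
  have f: "inner_torus L ?f ?f = real L ^ 3 * (w \<bullet> w)" by (simp add: inner_torus_def card_cell)
  have e: "((\<Sum>s\<in>sites L. S s) \<bullet> w)\<^sup>2 * gauss_weight \<kappa> \<tau> L S = (quad_form \<kappa> \<tau> L ?f (lift_config L S))\<^sup>2 * gauss_weight \<kappa> \<tau> L S / \<tau>\<^sup>2" for S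
    using assms unfolding Q s by (simp add: field_simps power_mult_distrib)
  note m = quad_form_second_moment[OF assms p]
  show "integrable (config_measure L) (\<lambda>S. ((\<Sum>s\<in>sites L. S s) \<bullet> w)\<^sup>2 * gauss_weight \<kappa> \<tau> L S)"
    unfolding e by (intro integrable_divide m)
  show "(\<integral>S. ((\<Sum>s\<in>sites L. S s) \<bullet> w)\<^sup>2 * gauss_weight \<kappa> \<tau> L S \<partial>config_measure L) = real L ^ 3 * (w \<bullet> w) / \<tau> * gauss_partition \<kappa> \<tau> L"
    unfolding e integral_divide_zero m unfolding Q f using assms by (simp add: field_simps power2_eq_square)
qed

section \<open>Logarithmic divergence of the mean square spin\<close>

text \<open>For \<open>L > 0\<close>, the graph distance from 0 to \<open>x\<close> on the cycle of
  length \<open>L\<close>.\<close>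

definition circle_dist :: "nat \<Rightarrow> int \<Rightarrow> nat" where
  "circle_dist L x = nat (min (x mod int L) ((- x) mod int L))"

lemma circle_dist_mod [simp]: "circle_dist L (x mod int L) = circle_dist L x"
  by (simp add: circle_dist_def mod_minus_eq)

lemma circle_dist_0 [simp]: "circle_dist L 0 = 0"
  by (simp add: circle_dist_def)

lemma circle_dist_cases:
  assumes "y \<in> {0..<int L}"
  shows "circle_dist L y = nat y \<or> circle_dist L y = L - nat y"
  using assms by (cases "y = 0") (auto simp: circle_dist_def zmod_zminus1_eq_if min_def)

lemma circle_dist_add_one:
  assumes "L > 0"
  shows "circle_dist L (x + 1) \<le> circle_dist L x + 1" "circle_dist L x \<le> circle_dist L (x + 1) + 1"
proof -
  define m where "m = x mod int L"
  have m: "0 \<le> m" "m < int L" using assms by (auto simp: m_def)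
  have x: "circle_dist L x = circle_dist L m" by (simp add: m_def)
  have x1: "circle_dist L (x + 1) = circle_dist L (m + 1)"
    by (metis circle_dist_mod m_def mod_add_left_eq)
  have c: "circle_dist L y = nat (min y (int L - y))" if "0 \<le> y" "y \<le> int L" for y
    using that assms
    by (cases "y = 0"; cases "y = int L") (auto simp: circle_dist_def zmod_zminus1_eq_if min_def)
  show "circle_dist L (x + 1) \<le> circle_dist L x + 1" "circle_dist L x \<le> circle_dist L (x + 1) + 1"
    unfolding x x1 using m by (auto simp: c)
qed

text \<open>Each distance \<open>a\<close> is taken at most twice, at \<open>a\<close> and at
  \<open>L - a\<close>.\<close>

lemma sum_circle_dist_le:
  fixes F :: "nat \<Rightarrow> real"
  assumes F: "\<And>a. F a \<ge> 0" "\<And>a. a > K \<Longrightarrow> F a = 0"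
  shows "(\<Sum>y\<in>{0..<int L}. F (circle_dist L y)) \<le> 2 * (\<Sum>a\<le>K. F a)"
proof -
  have fin: "(\<Sum>a\<in>A. F a) \<le> (\<Sum>a\<le>K. F a)" if "finite A" for A
  proof -
    have "(\<Sum>a\<in>A. F a) = (\<Sum>a\<in>A \<inter> {..K}. F a)"
      using that F(2) not_le by (intro sum.mono_neutral_right) blast+
    also have "\<dots> \<le> (\<Sum>a\<le>K. F a)"
      using F(1) by (intro sum_mono2) auto
    finally show ?thesis .
  qed
  have "(\<Sum>y\<in>{0..<int L}. F (circle_dist L y)) \<le> (\<Sum>y\<in>{0..<int L}. F (nat y) + F (L - nat y))"
  proof (rule sum_mono)
    fix y assume "y \<in> {0..<int L}"
    then show "F (circle_dist L y) \<le> F (nat y) + F (L - nat y)"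
      using circle_dist_cases[of y L] F(1)[of "nat y"] F(1)[of "L - nat y"] by auto
  qed
  also have "\<dots> = (\<Sum>a\<in>nat ` {0..<int L}. F a) + (\<Sum>a\<in>(\<lambda>y. L - nat y) ` {0..<int L}. F a)"
    by (subst (1 2) sum.reindex) (auto simp: inj_on_def sum.distrib)
  also have "\<dots> \<le> (\<Sum>a\<le>K. F a) + (\<Sum>a\<le>K. F a)"
    by (intro add_mono fin) auto
  finally show ?thesis by simp
qed

text \<open>There are \<open>2 k + 1\<close> pairs with maximum \<open>k\<close>; the induction adds
  a row, a column and a corner.\<close>

lemma sum_max_le:
  fixes F :: "nat \<Rightarrow> real"
  assumes F: "\<And>a. F a \<ge> 0"
  shows "(\<Sum>a\<le>K. \<Sum>b\<le>K. F (max a b)) \<le> (\<Sum>k\<le>K. 2 * real (Suc k) * F k)"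
proof (induction K)
  case (Suc K)
  have "(\<Sum>a\<le>Suc K. \<Sum>b\<le>Suc K. F (max a b)) =
     (\<Sum>a\<le>K. \<Sum>b\<le>K. F (max a b)) + (\<Sum>a\<le>K. F (Suc K)) + (\<Sum>b\<le>K. F (Suc K)) + F (Suc K)"
    by (simp add: sum.distrib max_def algebra_simps)
  also have "\<dots> \<le> (\<Sum>k\<le>K. 2 * real (Suc k) * F k) + 2 * real (Suc (Suc K)) * F (Suc K)"
    using Suc F[of "Suc K"] by (simp add: algebra_simps)
  finally show ?case by simp
qed (use F[of 0] in simp)

text \<open>The sphere of radius \<open>k\<close> in the plane has at most a multiple of
  \<open>k + 1\<close> points, uniformly in \<open>L\<close>. The 8 is a 2 for each circle times the
  2 of \<open>sum_max_le\<close>.\<close>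

lemma sum_circle_dist_max_le:
  fixes F :: "nat \<Rightarrow> real"
  assumes F: "\<And>a. F a \<ge> 0" "\<And>a. a > K \<Longrightarrow> F a = 0"
  shows "(\<Sum>y\<in>{0..<int L}. \<Sum>z\<in>{0..<int L}. F (max (circle_dist L y) (circle_dist L z))) \<le> 8 * (\<Sum>k\<le>K. real (Suc k) * F k)"
proof -
  have "(\<Sum>y\<in>{0..<int L}. \<Sum>z\<in>{0..<int L}. F (max (circle_dist L y) (circle_dist L z)))
     \<le> 2 * (\<Sum>a\<le>K. \<Sum>z\<in>{0..<int L}. F (max a (circle_dist L z)))"
    by (rule sum_circle_dist_le[where F = "\<lambda>a. \<Sum>z\<in>{0..<int L}. F (max a (circle_dist L z))"]) (auto intro!: sum_nonneg sum.neutral F)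
  also have "\<dots> \<le> 2 * (\<Sum>a\<le>K. 2 * (\<Sum>b\<le>K. F (max a b)))"
    by (intro mult_left_mono sum_mono sum_circle_dist_le[where F = "\<lambda>b. F (max _ b)"]) (auto intro!: F)
  also have "\<dots> = 4 * (\<Sum>a\<le>K. \<Sum>b\<le>K. F (max a b))"
    by (simp add: sum_distrib_left)
  also have "\<dots> \<le> 4 * (\<Sum>k\<le>K. 2 * real (Suc k) * F k)"
    by (intro mult_left_mono sum_max_le F) auto
  also have "\<dots> = 8 * (\<Sum>k\<le>K. real (Suc k) * F k)"
    by (simp add: sum_distrib_left algebra_simps)
  finally show ?thesis .
qed

section \<open>The logarithmic cutoff and its Dirichlet energy\<close>

text \<open>A discrete logarithmic potential, falling from 1 at the origin to 0 at radius
  \<open>N\<close>; harmonic numbers replace the logarithm.\<close>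

definition cutoff :: "nat \<Rightarrow> nat \<Rightarrow> real" where
  "cutoff N k = max 0 (1 - harm k / harm N)"

lemma cutoff_0 [simp]: "cutoff N 0 = 1"
  by (simp add: cutoff_def harm_def)

lemma cutoff_range: "0 \<le> cutoff N k" "cutoff N k \<le> 1"
  by (auto simp: cutoff_def harm_nonneg)

lemma cutoff_zero: "N > 0 \<Longrightarrow> k \<ge> N \<Longrightarrow> cutoff N k = 0"
  using harm_mono[of N k, where 'a = real] harm_pos[of N, where 'a = real] by (auto simp: cutoff_def field_simps)

lemma cutoff_Suc:
  assumes "N > 0"
  shows "\<bar>cutoff N (Suc k) - cutoff N k\<bar> \<le> 1 / (real (Suc k) * harm N)"
proof -
  have "(harm (Suc k) :: real) / harm N = harm k / harm N + 1 / (real (Suc k) * harm N)"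
    by (simp add: harm_Suc add_divide_distrib inverse_eq_divide del: of_nat_Suc)
  moreover have "1 / (real (Suc k) * harm N) \<ge> 0" by (simp add: harm_nonneg)
  ultimately show ?thesis unfolding cutoff_def by linarith
qed

text \<open>A bound on the squared increment to either side of \<open>k\<close>. The 4 is the square
  of a 2 that covers the inward step, whose increment is governed by \<open>1 / k\<close>. Radius
  \<open>N\<close> is included because of its step inwards.\<close>

definition cutoff_bound :: "nat \<Rightarrow> nat \<Rightarrow> real" where
  "cutoff_bound N k = (if k \<le> N then 4 / (real (Suc k) * harm N)\<^sup>2 else 0)"

lemma cutoff_diff:
  assumes "N > 0" "j \<le> k + 1" "k \<le> j + 1"
  shows "(cutoff N k - cutoff N j)\<^sup>2 \<le> cutoff_bound N k"
proof (cases "k \<le> N")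
  case False
  then show ?thesis using assms by (simp add: cutoff_zero cutoff_bound_def)
next
  case True
  have h: "(harm N :: real) > 0" using assms harm_pos by blast
  have "\<bar>cutoff N k - cutoff N j\<bar> \<le> 2 / (real (Suc k) * harm N)"
  proof -
    consider "j = k" | "j = Suc k" | "k = Suc j" using assms by linarith
    then show ?thesis
    proof cases
      case 1 then show ?thesis using h by (simp add: harm_nonneg)
    next
      case 2
      have "1 / (real (Suc k) * harm N) \<le> 2 / (real (Suc k) * harm N)"
        using h by (intro divide_right_mono) (auto simp: harm_nonneg)
      with cutoff_Suc[OF assms(1), of k] 2 show ?thesis by (simp add: abs_minus_commute)
    next
      case 3
      have "1 / (real (Suc j) * harm N) \<le> 2 / (real (Suc k) * harm N)"
      proof -
        have "real (Suc k) \<le> 2 * real (Suc j)" using 3 by simp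
        then have "real (Suc k) * harm N \<le> 2 * real (Suc j) * harm N" by (intro mult_right_mono) (auto simp: harm_nonneg)
        then have "2 / (2 * real (Suc j) * harm N) \<le> 2 / (real (Suc k) * harm N)"
          using h by (intro divide_left_mono) auto
        then show ?thesis by (simp add: mult.assoc del: of_nat_Suc)
      qed
      with cutoff_Suc[OF assms(1), of j] 3 show ?thesis by simp
    qed
  qed
  then have "(cutoff N k - cutoff N j)\<^sup>2 \<le> (2 / (real (Suc k) * harm N))\<^sup>2"
    by (metis abs_ge_zero power2_abs power_mono)
  then show ?thesis using True by (simp add: cutoff_bound_def power_divide)
qed

text \<open>The trial field lives on the plane \<open>x = 0\<close> and points in the direction \<open>(0, 1)\<close> orthogonal to \<open>vec_a\<close>,
  so that it only costs the two-dimensional Dirichlet energy of the logarithmic cutoff.\<close>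

definition trial :: "nat \<Rightarrow> nat \<Rightarrow> lattice_field" where
  "trial N L r = (case r of (x, y, z) \<Rightarrow>
     (0, if x mod int L = 0 then cutoff N (max (circle_dist L y) (circle_dist L z)) else 0))"

lemma periodic_trial: "periodic L (trial N L)"
  by (auto simp: periodic_def trial_def reduce_def)

lemma trial_0: "trial N L 0 = (0, 1)"
  by (simp add: trial_def zero_prod_def)

lemma sum_cell_plane:
  assumes "L > 0"
  shows "(\<Sum>(x, y, z)\<in>cell L. if x mod int L = 0 then F y z else 0) = (\<Sum>y\<in>{0..<int L}. \<Sum>z\<in>{0..<int L}. (F y z :: real))"
proof -
  have "(\<Sum>(x, y, z)\<in>cell L. if x mod int L = 0 then F y z else 0)
     = (\<Sum>x\<in>{0..<int L}. \<Sum>y\<in>{0..<int L}. \<Sum>z\<in>{0..<int L}. if x mod int L = 0 then F y z else 0)"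
    by (simp only: cell_def sum.cartesian_product)
  also have "\<dots> = (\<Sum>x\<in>{0..<int L}. if x = 0 then (\<Sum>y\<in>{0..<int L}. \<Sum>z\<in>{0..<int L}. F y z) else 0)"
    by (intro sum.cong) auto
  also have "\<dots> = (\<Sum>y\<in>{0..<int L}. \<Sum>z\<in>{0..<int L}. F y z)"
    using assms by (subst sum.delta) auto
  finally show ?thesis .
qed

text \<open>The weight \<open>k + 1\<close> of a planar sphere leaves one power of
  \<open>1 / (k + 1)\<close>, hence a single harmonic sum against the square of
  \<open>harm N\<close>. This is where recurrence of the plane enters.\<close>

lemma sum_cutoff_bound:
  assumes "N > 0"
  shows "(\<Sum>k\<le>N. real (Suc k) * cutoff_bound N k) \<le> 8 / harm N"
proof -
  let ?H = "harm N :: real"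
  have h: "?H \<ge> 1"
    using harm_mono[of 1 N, where 'a = real] assms by (simp add: harm_def)
  have "(\<Sum>k\<le>N. real (Suc k) * cutoff_bound N k) = (\<Sum>k\<le>N. inverse (real (Suc k)) * (4 / ?H\<^sup>2))"
    by (intro sum.cong) (auto simp: cutoff_bound_def power2_eq_square divide_simps simp del: of_nat_Suc)
  also have "\<dots> = harm (Suc N) * (4 / ?H\<^sup>2)"
    unfolding harm_def sum_distrib_right by (intro sum.reindex_bij_witness[where i = "\<lambda>k. k - 1" and j = Suc]) auto
  also have "\<dots> \<le> (2 * ?H) * (4 / ?H\<^sup>2)"
  proof (intro mult_right_mono)
    have "inverse (real (Suc N)) \<le> 1" by (simp add: field_simps)
    then show "harm (Suc N) \<le> 2 * ?H" using h by (simp add: harm_Suc)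
  qed auto
  also have "\<dots> = 8 / ?H" using h by (simp add: power2_eq_square)
  finally show ?thesis .
qed

text \<open>Bonds normal to the plane cost nothing. Each of the two in-plane directions costs at
  most 8 times the 8 of \<open>sum_cutoff_bound\<close>, over \<open>harm N\<close>.\<close>

lemma trial_energy_le:
  assumes "N > 0" "L > 0"
  shows "energy L (trial N L) (trial N L) \<le> 128 / harm N"
proof -
  let ?m = "\<lambda>y z. max (circle_dist L y) (circle_dist L z)"
  let ?B = "\<Sum>y\<in>{0..<int L}. \<Sum>z\<in>{0..<int L}. cutoff_bound N (?m y z)"
  have a: "energy_dir L unit_x vec_a (trial N L) (trial N L) = 0"
    unfolding energy_dir_def
    by (intro sum.neutral) (auto simp: trial_def vec_a_def inner_prod_def split: prod.splits)
  \<comment> \<open>Treats both in-plane directions at once: the step keeps \<open>x\<close> and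
    changes the planar distance by at most one.\<close>
  have dir: "energy_dir L e v (trial N L) (trial N L) \<le> ?B"
    if v: "(snd v)\<^sup>2 \<le> 1"
      and e: "\<And>x y z. \<exists>y' z'. (x, y, z) + e = (x, y', z') \<and> ?m y' z' \<le> ?m y z + 1 \<and> ?m y z \<le> ?m y' z' + 1" for e v
  proof -
    have "energy_dir L e v (trial N L) (trial N L)
       \<le> (\<Sum>(x, y, z)\<in>cell L. if x mod int L = 0 then cutoff_bound N (?m y z) else 0)"
      unfolding energy_dir_def
    proof (intro sum_mono, clarify)
      fix x y z
      obtain y' z' where yz: "(x, y, z) + e = (x, y', z')" "?m y' z' \<le> ?m y z + 1" "?m y z \<le> ?m y' z' + 1"
        using e by blast
      have "(cutoff N (?m y z) - cutoff N (?m y' z'))\<^sup>2 * (snd v)\<^sup>2 \<le> cutoff_bound N (?m y z) * 1"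
        using yz v by (intro mult_mono cutoff_diff assms) (auto simp: cutoff_bound_def)
      then show "((trial N L (x, y, z) - trial N L ((x, y, z) + e)) \<bullet> v) * ((trial N L (x, y, z) - trial N L ((x, y, z) + e)) \<bullet> v)
         \<le> (if x mod int L = 0 then cutoff_bound N (?m y z) else 0)"
        unfolding yz(1) by (simp add: trial_def inner_prod_def power2_eq_square algebra_simps)
    qed
    also have "\<dots> = ?B" by (rule sum_cell_plane[OF assms(2)])
    finally show ?thesis .
  qed
  have b: "energy_dir L unit_y vec_b (trial N L) (trial N L) \<le> ?B"
  proof (rule dir)
    fix x y z
    show "\<exists>y' z'. (x, y, z) + unit_y = (x, y', z') \<and> ?m y' z' \<le> ?m y z + 1 \<and> ?m y z \<le> ?m y' z' + 1"
      using circle_dist_add_one[OF assms(2), of y] by (intro exI[of _ "y + 1"] exI[of _ z]) (auto simp: unit_y_def)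
  qed (simp add: vec_b_def power_divide)
  have c: "energy_dir L unit_z vec_c (trial N L) (trial N L) \<le> ?B"
  proof (rule dir)
    fix x y z
    show "\<exists>y' z'. (x, y, z) + unit_z = (x, y', z') \<and> ?m y' z' \<le> ?m y z + 1 \<and> ?m y z \<le> ?m y' z' + 1"
      using circle_dist_add_one[OF assms(2), of z] by (intro exI[of _ y] exI[of _ "z + 1"]) (auto simp: unit_z_def)
  qed (simp add: vec_c_def power_divide)
  have "?B \<le> 8 * (\<Sum>k\<le>N. real (Suc k) * cutoff_bound N k)"
    by (rule sum_circle_dist_max_le) (auto simp: cutoff_bound_def)
  with sum_cutoff_bound[OF assms(1)] a b c show ?thesis
    unfolding energy_def by simp
qed

text \<open>A crude bound is enough: it is uniform in \<open>L\<close>, and \<open>\<tau>\<close>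
  will be chosen after \<open>N\<close>.\<close>

lemma trial_inner_torus_le:
  assumes "N > 0" "L > 0"
  shows "inner_torus L (trial N L) (trial N L) \<le> 8 * (\<Sum>k\<le>N. real (Suc k))"
proof -
  let ?F = "\<lambda>k. if k \<le> N then 1 else 0 :: real"
  let ?m = "\<lambda>y z. max (circle_dist L y) (circle_dist L z)"
  have "inner_torus L (trial N L) (trial N L) \<le> (\<Sum>(x, y, z)\<in>cell L. if x mod int L = 0 then ?F (?m y z) else 0)"
    unfolding inner_torus_def
  proof (intro sum_mono, clarify)
    fix x y z
    have "cutoff N k * cutoff N k \<le> ?F k" for k
      using cutoff_range[of N k] assms by (auto intro: mult_le_one simp: cutoff_zero)
    from this[of "?m y z"]
    show "trial N L (x, y, z) \<bullet> trial N L (x, y, z) \<le> (if x mod int L = 0 then ?F (?m y z) else 0)"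
      by (simp add: trial_def inner_prod_def)
  qed
  also have "\<dots> = (\<Sum>y\<in>{0..<int L}. \<Sum>z\<in>{0..<int L}. ?F (?m y z))"
    by (rule sum_cell_plane[OF assms(2)])
  also have "\<dots> \<le> 8 * (\<Sum>k\<le>N. real (Suc k) * ?F k)"
    by (rule sum_circle_dist_max_le) auto
  also have "(\<Sum>k\<le>N. real (Suc k) * ?F k) = (\<Sum>k\<le>N. real (Suc k))"
    by (intro sum.cong) auto
  finally show ?thesis .
qed

section \<open>Variational lower bound on the mean square spin\<close>

text \<open>Cauchy-Schwarz for \<open>Q\<close> between the trial field \<open>g\<close> and the
  resolvent \<open>f\<close>. By the reproducing property \<open>Q(g, f) = 1\<close> and
  \<open>Q(f, f)\<close> is a diagonal entry of the resolvent, so that entry is at least the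
  reciprocal of a bound on \<open>Q(g, g)\<close>.\<close>

lemma mean_sq_ge:
  assumes "L > 0" "\<tau> > 0" "N > 0"
  shows "mean_sq 1 \<tau> L \<ge> 1 / (128 / harm N + \<tau> * (8 * (\<Sum>k\<le>N. real (Suc k))))"
proof -
  define q where "q = 128 / harm N + \<tau> * (8 * (\<Sum>k\<le>N. real (Suc k)))"
  let ?Q = "quad_form 1 \<tau> L"
  let ?g = "trial N L"
  let ?f = "resolvent 1 \<tau> L 0 (0, 1)"
  let ?c = "?f 0 \<bullet> (0, 1)"
  have res: "?Q h (resolvent 1 \<tau> L r w) = h r \<bullet> w" if "periodic L h" for h r w
    using quad_form_resolvent[OF assms(1) zero_less_one assms(2) that] .
  have q: "q > 0"
    unfolding q_def
    using assms harm_pos[of N, where 'a = real]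
    by (intro add_pos_nonneg) (auto intro!: mult_nonneg_nonneg sum_nonneg)
  have "?Q ?g ?g \<le> q"
    unfolding quad_form_def q_def using trial_energy_le[OF assms(3,1)] trial_inner_torus_le[OF assms(3,1)] assms(2)
    by (simp add: mult_left_mono add_mono)
  \<comment> \<open>With \<open>Q(g, g) \<le> q\<close>, nonnegativity at \<open>g - q f\<close>
    reads \<open>0 \<le> q - 2 q + q^2 c\<close>.\<close>
  moreover have "?Q (\<lambda>r. ?g r + (- q) *\<^sub>R ?f r) (\<lambda>r. ?g r + (- q) *\<^sub>R ?f r) \<ge> 0"
    using assms by (intro quad_form_nonneg) auto
  moreover have "?Q (\<lambda>r. ?g r + (- q) *\<^sub>R ?f r) (\<lambda>r. ?g r + (- q) *\<^sub>R ?f r) = ?Q ?g ?g - 2 * q + q\<^sup>2 * ?c"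
  proof -
    have "?Q ?g ?f = 1" "?Q ?f ?g = 1"
      using res[OF periodic_trial, of N 0 "(0,1)"] quad_form_sym[of 1 \<tau> L ?f ?g] by (simp_all add: trial_0)
    moreover have "?Q ?f ?f = ?c" by (rule res) simp
    ultimately show ?thesis
      unfolding quad_form_lin_left quad_form_lin_right by (simp add: algebra_simps power2_eq_square)
  qed
  ultimately have "q \<le> q\<^sup>2 * ?c" by linarith
  then have "1 / q \<le> ?c" using q by (simp add: power2_eq_square field_simps)
  moreover have "resolvent 1 \<tau> L 0 (1, 0) 0 \<bullet> (1, 0) \<ge> 0"
    using res[of "resolvent 1 \<tau> L 0 (1, 0)" 0 "(1,0)"] quad_form_nonneg[of 1 \<tau> L] assms
    by (metis less_imp_le periodic_resolvent zero_le_one)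
  ultimately show ?thesis
    using mean_sq_resolvent[OF zero_less_one assms(2), of L 0] unfolding q_def by linarith
qed

section \<open>Free energy and infinite-volume limits\<close>

text \<open>Stated for real and complex arguments alike, since the same coefficients serve the real
  identities and the holomorphic extensions.\<close>

lemma summable_coeff_bound:
  fixes z :: "'a::{real_normed_field,banach}"
  assumes a: "\<And>n. \<bar>a n\<bar> \<le> 2 * 6 ^ n" and z: "norm z < 1 / 6"
  shows "summable (\<lambda>n. of_real (a n) * z ^ n)"
proof (rule summable_comparison_test)
  show "summable (\<lambda>n. 2 * (6 * norm z) ^ n)"
    using z by (intro summable_mult summable_geometric) auto
  show "\<exists>N. \<forall>n\<ge>N. norm (of_real (a n) * z ^ n) \<le> 2 * (6 * norm z) ^ n"
  proof (intro exI allI impI)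
    fix n
    have "\<bar>a n\<bar> * norm z ^ n \<le> 2 * 6 ^ n * norm z ^ n"
      by (intro mult_right_mono a) auto
    then show "norm (of_real (a n) * z ^ n) \<le> 2 * (6 * norm z) ^ n"
      by (simp add: norm_mult norm_power power_mult_distrib)
  qed
qed

lemma coeff_series_deriv:
  fixes z :: "'a::{real_normed_field,banach}"
  assumes a: "\<And>n. \<bar>a n\<bar> \<le> 2 * 6 ^ n" and z: "norm z < 1 / 6"
  shows "((\<lambda>z. \<Sum>n. of_real (a n) * z ^ n) has_field_derivative (\<Sum>n. diffs (\<lambda>n. of_real (a n)) n * z ^ n)) (at z)"
  by (rule termdiffs_strong'[where K = "1/6"]) (use a z summable_coeff_bound in auto)

text \<open>The term \<open>n = 0\<close> vanishes since division by zero yields zero.\<close>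

definition log_series :: "nat \<Rightarrow> real \<Rightarrow> real" where
  "log_series L v = (\<Sum>n. moment L n / real n * v ^ n)"

lemma moment_bound: "\<bar>moment L n\<bar> \<le> 2 * 6 ^ n"
  using moment_nonneg[of L n] moment_le[of L n] by simp

lemma moment_div_bound: "\<bar>moment L n / real n\<bar> \<le> 2 * 6 ^ n"
proof (cases "n = 0")
  case False
  then have "\<bar>moment L n / real n\<bar> \<le> \<bar>moment L n\<bar>"
    by (simp add: divide_le_eq mult_le_cancel_left1)
  then show ?thesis using moment_bound[of L n] by linarith
qed simp

lemma log_series_deriv:
  assumes "\<bar>v\<bar> < 1 / 6"
  shows "(log_series L has_real_derivative (\<Sum>n. moment L (Suc n) * v ^ n)) (at v)"
proof -
  have "diffs (\<lambda>n. moment L n / real n) n = moment L (Suc n)" for n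
    by (simp add: diffs_def)
  then show ?thesis
    using coeff_series_deriv[OF moment_div_bound[of L], of v] assms by (simp add: log_series_def[abs_def])
qed

text \<open>The second form splits off the constant term, to match the derivatives of the logarithm
  and of \<open>log_series\<close> in \<open>free_energy_finite\<close>.\<close>

lemma mean_sq_eq_series:
  assumes "\<kappa> > 0" "\<tau> > 0"
  shows "mean_sq \<kappa> \<tau> L = (\<Sum>n. moment L n * (\<kappa> / (6 * \<kappa> + \<tau>)) ^ n) / (6 * \<kappa> + \<tau>)"
    and "mean_sq \<kappa> \<tau> L = 2 / (6 * \<kappa> + \<tau>) + (\<Sum>n. moment L (Suc n) * (\<kappa> / (6 * \<kappa> + \<tau>)) ^ n) * \<kappa> / (6 * \<kappa> + \<tau>)\<^sup>2"
proof -
  let ?T = "6 * \<kappa> + \<tau>" let ?v = "\<kappa> / ?T"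
  have v: "\<bar>?v\<bar> < 1 / 6" using assms by (simp add: field_simps)
  have s: "summable (\<lambda>n. moment L n * ?v ^ n)"
    using summable_coeff_bound[OF moment_bound[of L], of ?v] v by simp
  have "mean_sq \<kappa> \<tau> L = (\<Sum>n. moment L n * ?v ^ n / ?T)"
    unfolding mean_sq_def by (simp add: power_divide mult_ac)
  then show 1: "mean_sq \<kappa> \<tau> L = (\<Sum>n. moment L n * ?v ^ n) / ?T"
    using suminf_divide[OF s] by simp
  have s': "summable (\<lambda>n. moment L (Suc n) * ?v ^ n)"
  proof -
    have "summable (\<lambda>n. moment L (Suc n) * ?v ^ Suc n)" using s by (subst summable_Suc_iff)
    then have "summable (\<lambda>n. moment L (Suc n) * ?v ^ Suc n / ?v)" by (rule summable_divide)
    then show ?thesis using assms by simp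
  qed
  have "(\<Sum>n. moment L n * ?v ^ n) = 2 + (\<Sum>n. moment L (Suc n) * ?v ^ n * ?v)"
    using suminf_split_head[OF s] by (simp add: mult_ac)
  also have "(\<Sum>n. moment L (Suc n) * ?v ^ n * ?v) = (\<Sum>n. moment L (Suc n) * ?v ^ n) * ?v"
    by (rule suminf_mult2[OF s', symmetric])
  finally show "mean_sq \<kappa> \<tau> L = 2 / ?T + (\<Sum>n. moment L (Suc n) * ?v ^ n) * \<kappa> / ?T\<^sup>2"
    unfolding 1 by (simp add: add_divide_distrib power2_eq_square)
qed

section \<open>The free energy from its derivative in \<open>\<tau>\<close>\<close>

lemma isCont_mean_sq:
  assumes "\<kappa> > 0" "\<tau> > 0"
  shows "isCont (\<lambda>\<tau>. mean_sq \<kappa> \<tau> L) \<tau>"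
proof -
  have v: "\<bar>\<kappa> / (6 * \<kappa> + \<tau>)\<bar> < 1 / 6" using assms by (simp add: field_simps)
  have c: "isCont (\<lambda>v::real. \<Sum>n. moment L n * v ^ n) (\<kappa> / (6 * \<kappa> + \<tau>))"
    using DERIV_isCont[OF coeff_series_deriv[OF moment_bound[of L], of "\<kappa> / (6 * \<kappa> + \<tau>)"]] v by simp
  have "isCont (\<lambda>\<tau>. (\<Sum>n. moment L n * (\<kappa> / (6 * \<kappa> + \<tau>)) ^ n) / (6 * \<kappa> + \<tau>)) \<tau>"
  proof (rule isCont_divide)
    have "isCont (\<lambda>\<tau>. \<kappa> / (6 * \<kappa> + \<tau>)) \<tau>"
      using assms by (intro continuous_intros) auto
    then show "isCont (\<lambda>\<tau>. \<Sum>n. moment L n * (\<kappa> / (6 * \<kappa> + \<tau>)) ^ n) \<tau>"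
      using c by (rule isCont_o2[where f = "\<lambda>\<tau>. \<kappa> / (6 * \<kappa> + \<tau>)" and g = "\<lambda>v. \<Sum>n. moment L n * v ^ n"])
  qed (use assms in auto)
  moreover have ev: "\<forall>\<^sub>F t in nhds \<tau>. mean_sq \<kappa> t L = (\<Sum>n. moment L n * (\<kappa> / (6 * \<kappa> + t)) ^ n) / (6 * \<kappa> + t)"
    by (rule eventually_mono[OF eventually_nhds_in_open[of "{0<..}" \<tau>]])
       (use assms mean_sq_eq_series(1) in auto)
  ultimately show ?thesis using isCont_cong[OF ev] by blast
qed

text \<open>Gibbs variational inequality: \<open>exp x \<ge> 1 + x\<close> at the mean of the constraint.\<close>

lemma ln_gauss_partition_supporting_line:
  assumes "L > 0" "\<kappa> > 0" "\<tau> > 0" "\<tau>' > 0"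
  shows "ln (gauss_partition \<kappa> \<tau>' L) - ln (gauss_partition \<kappa> \<tau> L) \<ge> - (real L ^ 3 * mean_sq \<kappa> \<tau> L) / 2 * (\<tau>' - \<tau>)"
proof -
  let ?M = "config_measure L"
  define n where "n = real L ^ 3 * mean_sq \<kappa> \<tau> L"
  define d where "d = (\<tau>' - \<tau>) / 2"
  define Z where "Z = gauss_partition \<kappa> \<tau> L"
  note c = constraint_moment[OF assms(1-3)] and w = integrable_gauss_weight[OF assms(1-3)]
  have le: "exp (- d * n) * (gauss_weight \<kappa> \<tau> L S - d * (constraint L S * gauss_weight \<kappa> \<tau> L S) + d * n * gauss_weight \<kappa> \<tau> L S) \<le> gauss_weight \<kappa> \<tau>' L S" for S
  proof -
    have "gauss_weight \<kappa> \<tau>' L S = exp (- d * n) * (exp (- d * (constraint L S - n)) * gauss_weight \<kappa> \<tau> L S)"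
    proof -
      have "- (\<kappa> * e + \<tau>' * N) / 2 = - d * n + (- d * (N - n) + - (\<kappa> * e + \<tau> * N) / 2)" for e N
        by (simp add: d_def diff_divide_distrib add_divide_distrib algebra_simps)
      then show ?thesis
        unfolding gauss_weight_def quad_form_def constraint_eq[OF assms(1)] exp_add[symmetric] by simp
    qed
    moreover have "(1 - d * (constraint L S - n)) * gauss_weight \<kappa> \<tau> L S \<le> exp (- d * (constraint L S - n)) * gauss_weight \<kappa> \<tau> L S"
      using exp_ge_add_one_self[of "- d * (constraint L S - n)"] by (intro mult_right_mono) (auto simp: gauss_weight_def)
    then have "exp (- d * n) * ((1 - d * (constraint L S - n)) * gauss_weight \<kappa> \<tau> L S) \<le> exp (- d * n) * (exp (- d * (constraint L S - n)) * gauss_weight \<kappa> \<tau> L S)"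
      by (intro mult_left_mono) auto
    ultimately show ?thesis by (simp add: algebra_simps)
  qed
  have i: "integrable ?M (\<lambda>S. exp (- d * n) * (gauss_weight \<kappa> \<tau> L S - d * (constraint L S * gauss_weight \<kappa> \<tau> L S) + d * n * gauss_weight \<kappa> \<tau> L S))"
    by (intro integrable_mult_right Bochner_Integration.integrable_add Bochner_Integration.integrable_diff c w)
  have "(\<integral>S. exp (- d * n) * (gauss_weight \<kappa> \<tau> L S - d * (constraint L S * gauss_weight \<kappa> \<tau> L S) + d * n * gauss_weight \<kappa> \<tau> L S) \<partial>?M) \<le> gauss_partition \<kappa> \<tau>' L"
    unfolding gauss_partition_def[of \<kappa> \<tau>'] by (rule integral_mono[OF i integrable_gauss_weight[OF assms(1,2,4)] le])
  \<comment> \<open>Since \<open>n\<close> is the mean of the constraint, the two terms linear in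
    \<open>d\<close> cancel.\<close>
  moreover have "(\<integral>S. exp (- d * n) * (gauss_weight \<kappa> \<tau> L S - d * (constraint L S * gauss_weight \<kappa> \<tau> L S) + d * n * gauss_weight \<kappa> \<tau> L S) \<partial>?M)
     = exp (- d * n) * (Z - d * (n * Z) + d * n * Z)"
    using c w by (simp add: n_def Z_def gauss_partition_def)
  ultimately have "exp (- d * n) * Z \<le> gauss_partition \<kappa> \<tau>' L" by simp
  moreover have Z: "Z > 0" unfolding Z_def by (rule gauss_partition_pos[OF assms(1-3)])
  ultimately have "ln (exp (- d * n) * Z) \<le> ln (gauss_partition \<kappa> \<tau>' L)"
    using gauss_partition_pos[OF assms(1,2,4)] by (subst ln_le_cancel_iff) auto
  moreover have "ln (exp (- d * n) * Z) = - d * n + ln Z"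
    using Z by (simp add: ln_mult)
  moreover have "- n / 2 * (\<tau>' - \<tau>) = - d * n" by (simp add: d_def mult.commute)
  ultimately show ?thesis unfolding n_def[symmetric] Z_def[symmetric] by linarith
qed

text \<open>Supporting lines at \<open>x\<close> and at \<open>y\<close> trap the difference
  quotient between \<open>g x\<close> and \<open>g y\<close>, so continuity of \<open>g\<close>
  suffices. This replaces differentiation under the integral.\<close>

lemma deriv_of_supporting_lines:
  fixes G g :: "real \<Rightarrow> real"
  assumes S: "open S" "x \<in> S" and sup: "\<And>x y. x \<in> S \<Longrightarrow> y \<in> S \<Longrightarrow> G y - G x \<ge> g x * (y - x)" and cont: "isCont g x"
  shows "(G has_real_derivative g x) (at x)"
  unfolding has_field_derivative_iff
proof (rule Lim_transform_bound[where g = "\<lambda>y. g y - g x" and f = "\<lambda>y. (G y - G x) / (y - x) - g x", THEN LIM_zero_cancel])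
  have "\<forall>\<^sub>F y in at x. y \<in> S - {x}" using S by (rule eventually_at_in_open)
  then show "\<forall>\<^sub>F y in at x. norm ((G y - G x) / (y - x) - g x) \<le> norm (g y - g x)"
  proof (rule eventually_mono)
    fix y assume y: "y \<in> S - {x}"
    have a: "g x * (y - x) \<le> G y - G x" and b: "G y - G x \<le> g y * (y - x)"
      using sup[of x y] sup[of y x] y S by (auto simp: algebra_simps)
    show "norm ((G y - G x) / (y - x) - g x) \<le> norm (g y - g x)"
    proof (cases "y > x")
      case True
      then have "g x \<le> (G y - G x) / (y - x)" "(G y - G x) / (y - x) \<le> g y"
        using a b by (simp_all add: pos_le_divide_eq pos_divide_le_eq)
      then show ?thesis by simp
    next
      case False
      then have "y - x < 0" using y by auto
      then have "(G y - G x) / (y - x) \<le> g x" "g y \<le> (G y - G x) / (y - x)"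
        using a b by (simp_all add: neg_le_divide_eq neg_divide_le_eq)
      then show ?thesis by simp
    qed
  qed
  show "(\<lambda>y. g y - g x) \<midarrow>x\<rightarrow> 0" using cont by (simp add: isCont_def LIM_zero)
qed

text \<open>The difference of the two sides has derivative zero in \<open>\<tau>\<close>, hence is
  constant; letting \<open>\<tau>\<close> tend to infinity, where the spins decouple, identifies the
  constant.\<close>

lemma free_energy_finite:
  assumes "L > 0" "\<kappa> > 0" "\<tau> > 0"
  shows "ln (gauss_partition \<kappa> \<tau> L) / real L ^ 3 = ln (2 * pi) - ln (6 * \<kappa> + \<tau>) + log_series L (\<kappa> / (6 * \<kappa> + \<tau>)) / 2"
proof -
  let ?T = "\<lambda>t. 6 * \<kappa> + t"
  define D where "D t = ln (gauss_partition \<kappa> t L) / real L ^ 3 + ln (?T t) - log_series L (\<kappa> / ?T t) / 2" for t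
  have L3: "real L ^ 3 > 0" using assms by simp
  have dD: "(D has_real_derivative 0) (at t)" if t: "t > 0" for t
  proof -
    have T: "?T t > 0" using assms t by simp
    have v: "\<bar>\<kappa> / ?T t\<bar> < 1 / 6" using assms t by (simp add: field_simps)
    let ?s = "\<Sum>n. moment L (Suc n) * (\<kappa> / ?T t) ^ n"
    have d1: "((\<lambda>t. ln (gauss_partition \<kappa> t L)) has_real_derivative (- (real L ^ 3 * mean_sq \<kappa> t L) / 2)) (at t)"
    proof (rule deriv_of_supporting_lines[where S = "{0<..}"])
      show "isCont (\<lambda>t. - (real L ^ 3 * mean_sq \<kappa> t L) / 2) t"
        using isCont_mean_sq[OF assms(2) t] by (intro continuous_intros) auto
      fix x y :: real assume "x \<in> {0<..}" "y \<in> {0<..}"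
      then show "- (real L ^ 3 * mean_sq \<kappa> x L) / 2 * (y - x) \<le> ln (gauss_partition \<kappa> y L) - ln (gauss_partition \<kappa> x L)"
        using ln_gauss_partition_supporting_line[OF assms(1,2), of x y] by auto
    qed (use t in auto)
    have d2: "((\<lambda>t. log_series L (\<kappa> / ?T t)) has_real_derivative ?s * (- \<kappa> / (?T t)\<^sup>2)) (at t)"
      by (rule DERIV_chain2[where f = "log_series L" and g = "\<lambda>t. \<kappa> / ?T t", OF log_series_deriv[OF v]])
         (use T in \<open>auto intro!: derivative_eq_intros simp: power2_eq_square\<close>)
    have "(D has_real_derivative (- (real L ^ 3 * mean_sq \<kappa> t L) / 2 / real L ^ 3 + 1 / ?T t - ?s * (- \<kappa> / (?T t)\<^sup>2) / 2)) (at t)"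
      unfolding D_def[abs_def] using T
      by (intro DERIV_diff DERIV_add DERIV_cdivide d1 d2) (auto intro!: derivative_eq_intros)
    moreover have "- (real L ^ 3 * mean_sq \<kappa> t L) / 2 / real L ^ 3 + 1 / ?T t - ?s * (- \<kappa> / (?T t)\<^sup>2) / 2 = 0"
    proof -
      have "- (2 / T + s * \<kappa> / T\<^sup>2) / 2 + 1 / T - s * (- \<kappa> / T\<^sup>2) / 2 = 0" for T s :: real
        by (simp add: diff_divide_distrib)
      moreover have "- (real L ^ 3 * mean_sq \<kappa> t L) / 2 / real L ^ 3 = - mean_sq \<kappa> t L / 2" using L3 by simp
      ultimately show ?thesis unfolding mean_sq_eq_series(2)[OF assms(2) t] by (simp only:)
    qed
    ultimately show ?thesis by simp
  qed
  have "\<exists>c. \<forall>t\<in>{0<..}. D t = c"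
    by (rule has_field_derivative_zero_constant) (auto intro!: has_field_derivative_at_within dD)
  then obtain c where c: "\<And>t. t > 0 \<Longrightarrow> D t = c" by auto
  have lim1: "((\<lambda>t. log_series L (\<kappa> / ?T t)) \<longlongrightarrow> log_series L 0) at_top"
  proof (rule isCont_tendsto_compose[where g = "log_series L" and l = 0])
    show "isCont (log_series L) 0" using DERIV_isCont[OF log_series_deriv[of 0 L]] by simp
    show "((\<lambda>t. \<kappa> / ?T t) \<longlongrightarrow> 0) at_top" by real_asymp
  qed
  have l0: "log_series L 0 = 0" unfolding log_series_def by (subst powser_zero) simp
  \<comment> \<open>The two independent-spin bounds differ by
    \<open>ln (6 * \<kappa> + t) - ln t\<close> per site, which tends to 0.\<close>
  have lim2: "((\<lambda>t. ln (gauss_partition \<kappa> t L) / real L ^ 3 + ln (?T t)) \<longlongrightarrow> ln (2 * pi)) at_top"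
  proof (rule tendsto_sandwich[where f = "\<lambda>t. ln (2 * pi)" and h = "\<lambda>t. ln (2 * pi) - ln t + ln (?T t)"])
    have b: "ln (2 * pi) - ln (?T t) \<le> ln (gauss_partition \<kappa> t L) / real L ^ 3 \<and> ln (gauss_partition \<kappa> t L) / real L ^ 3 \<le> ln (2 * pi) - ln t"
      if t: "t > 0" for t
    proof -
      have T: "?T t > 0" using assms t by simp
      have "ln ((2 * pi / ?T t) ^ (L ^ 3)) \<le> ln (gauss_partition \<kappa> t L)" "ln (gauss_partition \<kappa> t L) \<le> ln ((2 * pi / t) ^ (L ^ 3))"
        using gauss_partition_bounds[OF assms(1,2) t] gauss_partition_pos[OF assms(1,2) t] T t by (simp_all add: ln_mono)
      then have "real L ^ 3 * (ln (2 * pi) - ln (?T t)) \<le> ln (gauss_partition \<kappa> t L)" "ln (gauss_partition \<kappa> t L) \<le> real L ^ 3 * (ln (2 * pi) - ln t)"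
        using T t by (simp_all add: ln_realpow ln_div)
      then show ?thesis using L3 by (simp add: pos_le_divide_eq pos_divide_le_eq mult.commute)
    qed
    show "\<forall>\<^sub>F t in at_top. ln (2 * pi) \<le> ln (gauss_partition \<kappa> t L) / real L ^ 3 + ln (?T t)"
      using eventually_gt_at_top[of "0::real"]
    proof eventually_elim
      case (elim t)
      then show ?case using b[of t] by linarith
    qed
    show "\<forall>\<^sub>F t in at_top. ln (gauss_partition \<kappa> t L) / real L ^ 3 + ln (?T t) \<le> ln (2 * pi) - ln t + ln (?T t)"
      using eventually_gt_at_top[of "0::real"]
    proof eventually_elim
      case (elim t)
      then show ?case using b[of t] by linarith
    qed
    show "((\<lambda>t. ln (2 * pi) - ln t + ln (?T t)) \<longlongrightarrow> ln (2 * pi)) at_top" by real_asymp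
  qed auto
  have "(D \<longlongrightarrow> ln (2 * pi) - 0 / 2) at_top"
    unfolding D_def[abs_def] using lim1 unfolding l0 by (intro tendsto_diff lim2 tendsto_divide) auto
  moreover have "(D \<longlongrightarrow> c) at_top"
  proof (rule tendsto_eventually)
    show "\<forall>\<^sub>F t in at_top. D t = c"
      using eventually_gt_at_top[of "0::real"] by eventually_elim (rule c)
  qed
  ultimately have "c = ln (2 * pi)"
    using tendsto_unique[of "at_top :: real filter" D] by (simp add: trivial_limit_at_top_linorder)
  then show ?thesis using c[OF assms(3)] unfolding D_def by simp
qed

section \<open>Infinite-volume limits and decay of correlations\<close>

text \<open>Each term stabilises at a finite \<open>L\<close>, so a summable majorant alone
  justifies the exchange of limit and sum.\<close>

lemma tannery_eventually_const:
  fixes a :: "nat \<Rightarrow> nat \<Rightarrow> real"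
  assumes "\<And>n. \<forall>\<^sub>F L in sequentially. a n L = b n" "\<And>n L. \<bar>a n L\<bar> \<le> M n" "summable M"
  shows "(\<lambda>L. \<Sum>n. a n L) \<longlonglongrightarrow> (\<Sum>n. b n)"
proof -
  have "\<forall>\<^sub>F (k, n) in at_top \<times>\<^sub>F sequentially. norm (a k n) \<le> M k"
    using assms(2) by (intro always_eventually) auto
  from tannerys_theorem[OF tendsto_eventually[OF assms(1)] this assms(3)] show ?thesis by simp
qed

lemma moment_eventually: "\<forall>\<^sub>F L in sequentially. moment L n = moment 0 n"
  using eventually_gt_at_top[of n] by eventually_elim (rule moment_stable)

lemma mean_sq_tendsto:
  assumes "\<kappa> > 0" "\<tau> > 0"
  shows "mean_sq \<kappa> \<tau> \<longlonglongrightarrow> mean_sq \<kappa> \<tau> 0"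
  unfolding mean_sq_def[abs_def]
proof (rule tannery_eventually_const)
  show "summable (\<lambda>n. \<kappa> ^ n / (6 * \<kappa> + \<tau>) ^ Suc n * 6 ^ n * 2)"
    by (intro summable_mult2 summable_geom_bound assms)
  fix n L
  show "\<forall>\<^sub>F L in sequentially. \<kappa> ^ n / (6 * \<kappa> + \<tau>) ^ Suc n * moment L n = \<kappa> ^ n / (6 * \<kappa> + \<tau>) ^ Suc n * moment 0 n"
    using moment_eventually[of n] by eventually_elim simp
  have "\<kappa> ^ n / (6 * \<kappa> + \<tau>) ^ Suc n * \<bar>moment L n\<bar> \<le> \<kappa> ^ n / (6 * \<kappa> + \<tau>) ^ Suc n * (2 * 6 ^ n)"
    using assms by (intro mult_left_mono moment_bound) auto
  then show "\<bar>\<kappa> ^ n / (6 * \<kappa> + \<tau>) ^ Suc n * moment L n\<bar> \<le> \<kappa> ^ n / (6 * \<kappa> + \<tau>) ^ Suc n * 6 ^ n * 2"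
    using assms by (simp add: abs_mult mult_ac)
qed

lemma log_series_tendsto:
  assumes "\<bar>v\<bar> < 1 / 6"
  shows "(\<lambda>L. log_series L v) \<longlonglongrightarrow> log_series 0 v"
  unfolding log_series_def
proof (rule tannery_eventually_const)
  show "summable (\<lambda>n. 2 * (6 * \<bar>v\<bar>) ^ n)"
    using assms by (intro summable_mult summable_geometric) auto
  fix n L
  show "\<forall>\<^sub>F L in sequentially. moment L n / real n * v ^ n = moment 0 n / real n * v ^ n"
    using moment_eventually[of n] by eventually_elim simp
  have "\<bar>moment L n / real n\<bar> * \<bar>v\<bar> ^ n \<le> 2 * 6 ^ n * \<bar>v\<bar> ^ n"
    by (intro mult_right_mono moment_div_bound) auto
  then show "\<bar>moment L n / real n * v ^ n\<bar> \<le> 2 * (6 * \<bar>v\<bar>) ^ n"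
    by (simp add: abs_mult power_abs power_mult_distrib)
qed

lemma inner_hop_kernel_bound: "\<bar>hop_kernel n L w r \<bullet> w'\<bar> \<le> 6 ^ n * (norm w * norm w')"
  using Cauchy_Schwarz_ineq2[of "hop_kernel n L w r" w'] mult_right_mono[OF norm_hop_kernel_le[of n L w r], of "norm w'"]
  by (simp add: mult.assoc)

lemma resolvent_tendsto:
  assumes "\<kappa> > 0" "\<tau> > 0"
  shows "(\<lambda>L. resolvent \<kappa> \<tau> L r\<^sub>1 w\<^sub>1 r\<^sub>0 \<bullet> w\<^sub>0) \<longlonglongrightarrow> resolvent \<kappa> \<tau> 0 r\<^sub>1 w\<^sub>1 r\<^sub>0 \<bullet> w\<^sub>0"
  unfolding sums_unique[OF resolvent_inner[OF assms]]
proof (rule tannery_eventually_const)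
  show "summable (\<lambda>n. \<kappa> ^ n / (6 * \<kappa> + \<tau>) ^ Suc n * 6 ^ n * (norm w\<^sub>1 * norm w\<^sub>0))"
    by (intro summable_mult2 summable_geom_bound assms)
  fix n L
  let ?c = "\<kappa> ^ n / (6 * \<kappa> + \<tau>) ^ Suc n"
  have "\<forall>\<^sub>F L in sequentially. L > nat (sup_abs (r\<^sub>0 - r\<^sub>1) + int n)" by (rule eventually_gt_at_top)
  then show "\<forall>\<^sub>F L in sequentially. ?c * (hop_kernel n L w\<^sub>1 (r\<^sub>0 - r\<^sub>1) \<bullet> w\<^sub>0) = ?c * (hop_kernel n 0 w\<^sub>1 (r\<^sub>0 - r\<^sub>1) \<bullet> w\<^sub>0)"
    by eventually_elim (subst hop_kernel_stable, auto)
  have "?c * \<bar>hop_kernel n L w\<^sub>1 (r\<^sub>0 - r\<^sub>1) \<bullet> w\<^sub>0\<bar> \<le> ?c * (6 ^ n * (norm w\<^sub>1 * norm w\<^sub>0))"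
    using assms by (intro mult_left_mono inner_hop_kernel_bound) auto
  moreover have "\<bar>?c\<bar> = ?c" using assms by simp
  ultimately show "\<bar>?c * (hop_kernel n L w\<^sub>1 (r\<^sub>0 - r\<^sub>1) \<bullet> w\<^sub>0)\<bar> \<le> ?c * 6 ^ n * (norm w\<^sub>1 * norm w\<^sub>0)"
    by (simp only: abs_mult mult.assoc)
qed

text \<open>The 2 is a convenient bound for the square root of 3.\<close>

lemma sup_abs_le_euclid: "euclid_dist3 r r' \<le> 2 * real_of_int (sup_abs (r - r'))"
proof -
  obtain a b c where r: "r = (a, b, c)" by (rule prod_cases3)
  obtain a' b' c' where r': "r' = (a', b', c')" by (rule prod_cases3)
  define s where "s = sup_abs (r - r')"
  have le: "\<bar>a - a'\<bar> \<le> s" "\<bar>b - b'\<bar> \<le> s" "\<bar>c - c'\<bar> \<le> s"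
    by (simp_all add: s_def sup_abs_def r r')
  have sq: "x\<^sup>2 \<le> s\<^sup>2" if "\<bar>x\<bar> \<le> s" for x :: int
    using power_mono[OF that, of 2] by simp
  have "(a - a')\<^sup>2 + (b - b')\<^sup>2 + (c - c')\<^sup>2 \<le> 4 * s\<^sup>2"
    using sq[OF le(1)] sq[OF le(2)] sq[OF le(3)] zero_le_power2[of s] by linarith
  also have "\<dots> = (2 * s)\<^sup>2" by (simp add: power_mult_distrib)
  finally have "real_of_int ((a - a')\<^sup>2 + (b - b')\<^sup>2 + (c - c')\<^sup>2) \<le> real_of_int ((2 * s)\<^sup>2)"
    by (rule of_int_le_iff[THEN iffD2])
  then have "real_of_int ((a - a')\<^sup>2 + (b - b')\<^sup>2 + (c - c')\<^sup>2) \<le> (2 * real_of_int s)\<^sup>2"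
    by simp
  moreover have "0 \<le> s" using le(1) by linarith
  ultimately show ?thesis
    unfolding euclid_dist3_def s_def[symmetric] by (simp only: r r' prod.case) (intro real_le_lsqrt, auto)
qed

text \<open>Beyond sup distance \<open>N\<close> the first \<open>N\<close> terms vanish by finite
  propagation, and the rest is dominated by a tail that does not depend on the sites.\<close>

lemma resolvent_decay:
  assumes "\<kappa> > 0" "\<tau> > 0" "\<epsilon> > 0"
  shows "\<exists>R. \<forall>r r'. euclid_dist3 r r' \<ge> R \<longrightarrow> \<bar>resolvent \<kappa> \<tau> 0 r' w' r \<bullet> w\<bar> < \<epsilon>"
proof -
  define M where "M n = \<kappa> ^ n / (6 * \<kappa> + \<tau>) ^ Suc n * 6 ^ n * (norm w' * norm w)" for n
  have sM: "summable M" unfolding M_def by (intro summable_mult2 summable_geom_bound assms)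
  from suminf_exist_split[OF assms(3) sM] obtain N where N: "norm (\<Sum>i. M (i + N)) < \<epsilon>" by blast
  show ?thesis
  proof (intro exI[of _ "2 * (real N + 1)"] allI impI)
    fix r r' assume "2 * (real N + 1) \<le> euclid_dist3 r r'"
    with sup_abs_le_euclid[of r r'] have "real_of_int (int N) < real_of_int (sup_abs (r - r'))" by simp
    then have far: "sup_abs (r - r') > int N" by (simp only: of_int_less_iff)
    define t where "t n = \<kappa> ^ n / (6 * \<kappa> + \<tau>) ^ Suc n * (hop_kernel n 0 w' (r - r') \<bullet> w)" for n
    have t: "t sums (resolvent \<kappa> \<tau> 0 r' w' r \<bullet> w)"
      unfolding t_def by (rule resolvent_inner[OF assms(1,2)])
    have "t n = 0" if "n < N" for n
      using that far by (simp add: t_def hop_kernel_support)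
    then have "(\<Sum>i<N. t i) = 0" by simp
    then have t': "(\<lambda>n. t (n + N)) sums (resolvent \<kappa> \<tau> 0 r' w' r \<bullet> w)"
      using sums_iff_shift[of t N "resolvent \<kappa> \<tau> 0 r' w' r \<bullet> w"] t by simp
    have tM: "\<bar>t n\<bar> \<le> M n" for n
    proof -
      let ?c = "\<kappa> ^ n / (6 * \<kappa> + \<tau>) ^ Suc n"
      have "?c * \<bar>hop_kernel n 0 w' (r - r') \<bullet> w\<bar> \<le> ?c * (6 ^ n * (norm w' * norm w))"
        using assms by (intro mult_left_mono inner_hop_kernel_bound) auto
      moreover have "\<bar>?c\<bar> = ?c" using assms by simp
      ultimately show ?thesis unfolding t_def M_def by (simp only: abs_mult mult.assoc)
    qed
    have "norm (\<Sum>n. t (n + N)) \<le> (\<Sum>n. M (n + N))"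
    proof -
      have s: "summable (\<lambda>n. M (n + N))" using sM by (rule summable_ignore_initial_segment)
      have s': "summable (\<lambda>n. norm (t (n + N)))"
        by (rule summable_comparison_test[OF _ s]) (use tM in auto)
      have "norm (\<Sum>n. t (n + N)) \<le> (\<Sum>n. norm (t (n + N)))" by (rule summable_norm[OF s'])
      also have "\<dots> \<le> (\<Sum>n. M (n + N))" by (rule suminf_le[OF _ s' s]) (use tM in auto)
      finally show ?thesis .
    qed
    then show "\<bar>resolvent \<kappa> \<tau> 0 r' w' r \<bullet> w\<bar> < \<epsilon>"
      using N sums_unique[OF t'] by simp
  qed
qed

text \<open>First \<open>N\<close> makes the energy term small by divergence of the harmonic series,
  then \<open>\<tau>\<close> makes the mass term small. Neither choice involves \<open>L\<close>, so
  the lower bound survives the limit.\<close>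

lemma mean_sq_unbounded: "\<exists>\<tau>>0. mean_sq 1 \<tau> 0 \<ge> K"
proof -
  define K' where "K' = max K 1"
  have K': "K' > 0" "K \<le> K'" by (auto simp: K'_def)
  have "\<forall>\<^sub>F N in sequentially. harm N \<ge> 256 * K'"
    using harm_at_top by (simp add: filterlim_at_top)
  then have "\<forall>\<^sub>F N in sequentially. harm N \<ge> 256 * K' \<and> N > 0"
    using eventually_gt_at_top[of 0] by (rule eventually_conj)
  then obtain N where N: "harm N \<ge> 256 * K'" "N > 0"
    using eventually_happens'[OF sequentially_bot] by blast
  define C where "C = 8 * (\<Sum>k\<le>N. real (Suc k))"
  have C: "C > 0" unfolding C_def by (intro mult_pos_pos sum_pos) auto
  define \<tau> where "\<tau> = 1 / (2 * K' * C)"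
  have \<tau>: "\<tau> > 0" using K' C by (simp add: \<tau>_def)
  have h: "(harm N :: real) > 0" using N by (simp add: harm_pos)
  have "128 / harm N \<le> 1 / (2 * K')"
  proof -
    have "128 / harm N \<le> 128 / (256 * K')" using N K' h by (intro divide_left_mono mult_pos_pos) simp_all
    then show ?thesis by simp
  qed
  moreover have "\<tau> * C = 1 / (2 * K')" using C K' by (simp add: \<tau>_def)
  moreover have "1 / (2 * K') + 1 / (2 * K') = 1 / K'" by simp
  ultimately have "128 / harm N + \<tau> * C \<le> 1 / K'" by linarith
  then have "K' * (128 / harm N + \<tau> * C) \<le> K' * (1 / K')" using K' by (intro mult_left_mono) auto
  then have "K' * (128 / harm N + \<tau> * C) \<le> 1" using K' by simp
  moreover have "128 / harm N + \<tau> * C > 0" using h \<tau> C by (intro add_pos_pos) auto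
  ultimately have q: "K' \<le> 1 / (128 / harm N + \<tau> * C)"
    by (simp only: pos_le_divide_eq)
  have "K' \<le> mean_sq 1 \<tau> 0"
  proof (rule tendsto_lowerbound[OF mean_sq_tendsto[OF zero_less_one \<tau>]])
    show "\<forall>\<^sub>F L in sequentially. K' \<le> mean_sq 1 \<tau> L"
      using eventually_gt_at_top[of 0]
    proof eventually_elim
      case (elim L)
      then show ?case using q mean_sq_ge[OF elim \<tau> N(2), folded C_def] by linarith
    qed
  qed simp
  with K'(2) have "K \<le> mean_sq 1 \<tau> 0" by linarith
  with \<tau> show ?thesis by blast
qed

section \<open>Real analyticity and the theorem\<close>

text \<open>Encoded by a holomorphic function that agrees with \<open>f\<close> on the real axis
  near \<open>x\<close>, so that sums, products, reciprocals and compositions come from complex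
  analysis.\<close>

definition real_analytic_at :: "(real \<Rightarrow> real) \<Rightarrow> real \<Rightarrow> bool" where
  "real_analytic_at f x \<longleftrightarrow> (\<exists>F. F analytic_on {complex_of_real x} \<and> (\<forall>\<^sub>F y in nhds x. F (of_real y) = of_real (f y)))"

lemma real_analytic_onI:
  assumes "\<And>x. x \<in> A \<Longrightarrow> real_analytic_at f x"
  shows "real_analytic_on f A"
  unfolding real_analytic_on_def
proof
  fix x assume "x \<in> A"
  then obtain F where F: "F analytic_on {complex_of_real x}" "\<forall>\<^sub>F y in nhds x. F (of_real y) = of_real (f y)"
    using assms unfolding real_analytic_at_def by blast
  from F(1) obtain e where e: "e > 0" "F holomorphic_on ball (of_real x) e"
    by (auto simp: analytic_on_def)
  from F(2) obtain d where d: "d > 0" "\<And>y. dist y x < d \<Longrightarrow> F (of_real y) = of_real (f y)"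
    unfolding eventually_nhds_metric by blast
  \<comment> \<open>Real parts of the Taylor coefficients suffice because \<open>y - x\<close> and
    \<open>f y\<close> are real.\<close>
  define a where "a n = Re ((deriv ^^ n) F (of_real x) / fact n)" for n
  show "\<exists>\<rho>>0. \<exists>a. \<forall>y. \<bar>y - x\<bar> < \<rho> \<longrightarrow> (\<lambda>n. a n * (y - x) ^ n) sums f y"
  proof (intro exI[of _ "min d e"] exI[of _ a] conjI allI impI)
    show "min d e > 0" using d e by simp
    fix y assume y: "\<bar>y - x\<bar> < min d e"
    then have "complex_of_real y \<in> ball (of_real x) e"
      by (simp add: dist_norm abs_minus_commute flip: of_real_diff)
    from holomorphic_power_series[OF e(2) this]
    have "(\<lambda>n. (deriv ^^ n) F (of_real x) / fact n * (of_real y - of_real x) ^ n) sums F (of_real y)" .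
    from sums_Re[OF this] have "(\<lambda>n. Re ((deriv ^^ n) F (of_real x) / fact n * of_real ((y - x) ^ n))) sums Re (F (of_real y))"
      by (simp only: of_real_diff of_real_power)
    moreover have "Re (c * of_real t) = Re c * t" for c t by simp
    moreover have "Re (F (of_real y)) = f y" using d(2)[of y] y by (simp add: dist_real_def)
    ultimately show "(\<lambda>n. a n * (y - x) ^ n) sums f y"
      unfolding a_def by (simp only:)
  qed
qed

lemma real_analytic_at_ident: "real_analytic_at (\<lambda>x. x) x"
  unfolding real_analytic_at_def by (intro exI[of _ "\<lambda>z. z"]) (auto intro: analytic_intros)

lemma real_analytic_at_const: "real_analytic_at (\<lambda>_. c) x"
  unfolding real_analytic_at_def by (intro exI[of _ "\<lambda>_. of_real c"]) (auto intro: analytic_intros)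

lemma real_analytic_at_add:
  assumes "real_analytic_at f x" "real_analytic_at g x"
  shows "real_analytic_at (\<lambda>x. f x + g x) x"
proof -
  obtain F G where "F analytic_on {of_real x}" "\<forall>\<^sub>F y in nhds x. F (of_real y) = of_real (f y)"
    "G analytic_on {of_real x}" "\<forall>\<^sub>F y in nhds x. G (of_real y) = of_real (g y)"
    using assms unfolding real_analytic_at_def by blast
  then show ?thesis unfolding real_analytic_at_def
    by (intro exI[of _ "\<lambda>z. F z + G z"]) (auto intro: analytic_intros elim: eventually_elim2)
qed

lemma real_analytic_at_mult:
  assumes "real_analytic_at f x" "real_analytic_at g x"
  shows "real_analytic_at (\<lambda>x. f x * g x) x"
proof -
  obtain F G where "F analytic_on {of_real x}" "\<forall>\<^sub>F y in nhds x. F (of_real y) = of_real (f y)"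
    "G analytic_on {of_real x}" "\<forall>\<^sub>F y in nhds x. G (of_real y) = of_real (g y)"
    using assms unfolding real_analytic_at_def by blast
  then show ?thesis unfolding real_analytic_at_def
    by (intro exI[of _ "\<lambda>z. F z * G z"]) (auto intro: analytic_intros elim: eventually_elim2)
qed

lemma real_analytic_at_inverse:
  assumes "real_analytic_at f x" "f x \<noteq> 0"
  shows "real_analytic_at (\<lambda>x. inverse (f x)) x"
proof -
  obtain F where F: "F analytic_on {of_real x}" "\<forall>\<^sub>F y in nhds x. F (of_real y) = of_real (f y)"
    using assms unfolding real_analytic_at_def by blast
  have "F (of_real x) = of_real (f x)" using eventually_nhds_x_imp_x[OF F(2)] .
  with F assms show ?thesis unfolding real_analytic_at_def
    by (intro exI[of _ "\<lambda>z. inverse (F z)"]) (auto intro: analytic_on_inverse elim: eventually_mono)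
qed

lemma real_analytic_at_compose:
  assumes "real_analytic_at g x" "real_analytic_at f (g x)"
  shows "real_analytic_at (\<lambda>x. f (g x)) x"
proof -
  obtain F G where F: "F analytic_on {of_real (g x)}" "\<forall>\<^sub>F y in nhds (g x). F (of_real y) = of_real (f y)"
    and G: "G analytic_on {of_real x}" "\<forall>\<^sub>F y in nhds x. G (of_real y) = of_real (g y)"
    using assms unfolding real_analytic_at_def by blast
  have Gx: "G (of_real x) = of_real (g x)" using eventually_nhds_x_imp_x[OF G(2)] .
  \<comment> \<open>Continuity of \<open>g\<close> at \<open>x\<close>, inherited from its
    extension, is what pulls the agreement of \<open>F\<close> and \<open>f\<close> near
    \<open>g x\<close> back to a neighbourhood of \<open>x\<close>.\<close>
  have "isCont G (of_real x)" using G(1) by (rule analytic_at_imp_isCont)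
  then have "isCont (\<lambda>y. G (of_real y)) x"
    by (intro isCont_o2[where g = G and f = complex_of_real and a = x]) auto
  then have "isCont (\<lambda>y. Re (G (of_real y))) x" unfolding isCont_def by (rule tendsto_Re)
  moreover have ev: "\<forall>\<^sub>F y in nhds x. Re (G (of_real y)) = g y"
    using G(2) by eventually_elim simp
  ultimately have "isCont g x" using isCont_cong[OF ev] by blast
  then have "filterlim g (nhds (g x)) (nhds x)"
    by (simp add: isCont_def tendsto_at_iff_tendsto_nhds)
  from eventually_compose_filterlim[OF F(2) this]
  have "\<forall>\<^sub>F y in nhds x. F (of_real (g y)) = of_real (f (g y))" .
  with G(2) have "\<forall>\<^sub>F y in nhds x. (F \<circ> G) (of_real y) = of_real (f (g y))"
    by eventually_elim simp
  moreover have "(F \<circ> G) analytic_on {of_real x}"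
    by (rule analytic_on_compose[OF G(1)]) (use F(1) Gx in simp)
  ultimately show ?thesis unfolding real_analytic_at_def by blast
qed

lemma real_analytic_at_ln: "x > 0 \<Longrightarrow> real_analytic_at ln x"
  unfolding real_analytic_at_def
proof (intro exI[of _ Ln] conjI)
  assume x: "x > 0"
  have "Ln holomorphic_on (- \<real>\<^sub>\<le>\<^sub>0)" by (intro holomorphic_on_Ln) auto
  then have "Ln analytic_on (- \<real>\<^sub>\<le>\<^sub>0)" by (subst analytic_on_open) auto
  then show "Ln analytic_on {complex_of_real x}"
    by (rule analytic_on_subset) (use x in auto)
  have "\<forall>\<^sub>F y in nhds x. y \<in> {0<..}" using x by (intro eventually_nhds_in_open) auto
  then show "\<forall>\<^sub>F y in nhds x. Ln (of_real y) = of_real (ln y)"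
    by eventually_elim (simp add: Ln_of_real)
qed

section \<open>Analyticity of the coefficient series\<close>

lemma coeff_series_holomorphic:
  fixes a :: "nat \<Rightarrow> real"
  assumes "\<And>n. \<bar>a n\<bar> \<le> 2 * 6 ^ n"
  shows "(\<lambda>z::complex. \<Sum>n. of_real (a n) * z ^ n) holomorphic_on ball 0 (1 / 6)"
proof (rule holomorphic_onI)
  fix z :: complex assume "z \<in> ball 0 (1 / 6)"
  then have "norm z < 1 / 6" by simp
  from coeff_series_deriv[OF assms this]
  show "(\<lambda>z::complex. \<Sum>n. of_real (a n) * z ^ n) field_differentiable at z within ball 0 (1 / 6)"
    using field_differentiable_at_within field_differentiable_def by blast
qed

lemma coeff_series_of_real:
  fixes a :: "nat \<Rightarrow> real"
  assumes "\<And>n. \<bar>a n\<bar> \<le> 2 * 6 ^ n" "\<bar>v\<bar> < 1 / 6"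
  shows "(\<Sum>n. of_real (a n) * complex_of_real v ^ n) = of_real (\<Sum>n. a n * v ^ n)"
proof -
  have "summable (\<lambda>n. a n * v ^ n)" using summable_coeff_bound[OF assms(1), where z = v] assms(2) by simp
  from suminf_of_real[OF this, where 'a = complex] show ?thesis by simp
qed

lemma real_analytic_at_coeff_series:
  fixes a :: "nat \<Rightarrow> real"
  assumes "\<And>n. \<bar>a n\<bar> \<le> 2 * 6 ^ n" "\<bar>x\<bar> < 1 / 6"
  shows "real_analytic_at (\<lambda>v. \<Sum>n. a n * v ^ n) x"
  unfolding real_analytic_at_def
proof (intro exI[of _ "\<lambda>z::complex. \<Sum>n. of_real (a n) * z ^ n"] conjI)
  show "(\<lambda>z::complex. \<Sum>n. of_real (a n) * z ^ n) analytic_on {of_real x}"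
    by (rule analytic_on_subset[of _ "ball 0 (1/6)"])
       (use assms in \<open>auto simp: analytic_on_open coeff_series_holomorphic\<close>)
  have "\<forall>\<^sub>F y in nhds x. y \<in> {-1/6<..<1/6}" using assms(2) by (intro eventually_nhds_in_open) auto
  then show "\<forall>\<^sub>F y in nhds x. (\<Sum>n. of_real (a n) * complex_of_real y ^ n) = of_real (\<Sum>n. a n * y ^ n)"
    by eventually_elim (intro coeff_series_of_real assms, auto)
qed

section \<open>The spin density and its analytic inverse\<close>

definition spin_density :: "real \<Rightarrow> real" where
  "spin_density v = v * (\<Sum>n. moment 0 n * v ^ n)"

text \<open>All coefficients are nonnegative and the lowest one is \<open>moment 0 0 = 2\<close>,
  which bounds the slope from below.\<close>

lemma spin_density_mono_strong:
  assumes "0 \<le> u" "u \<le> v" "v < 1 / 6"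
  shows "spin_density v - spin_density u \<ge> 2 * (v - u)"
proof -
  let ?A = "\<lambda>v. \<Sum>n. moment 0 n * v ^ n"
  have s: "summable (\<lambda>n. moment 0 n * x ^ n)" if "0 \<le> x" "x < 1 / 6" for x
    using summable_coeff_bound[OF moment_bound[of 0], where z = x] that by simp
  have 1: "?A u \<le> ?A v"
    by (intro suminf_le s mult_left_mono power_mono) (use assms moment_nonneg in auto)
  have "(\<Sum>n\<in>{0}. moment 0 n * v ^ n) \<le> ?A v"
    by (intro sum_le_suminf s) (use assms moment_nonneg in auto)
  then have 2: "2 \<le> ?A v" by simp
  have "spin_density v - spin_density u = (v - u) * ?A v + u * (?A v - ?A u)"
    by (simp add: spin_density_def algebra_simps)
  moreover have "(v - u) * ?A v \<ge> (v - u) * 2" using 2 assms by (intro mult_left_mono) auto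
  moreover have "u * (?A v - ?A u) \<ge> 0" using 1 assms by simp
  ultimately show ?thesis by linarith
qed

lemma spin_density_less:
  assumes "0 \<le> u" "u < v" "v < 1 / 6"
  shows "spin_density u < spin_density v"
  using spin_density_mono_strong[of u v] assms by simp

lemma spin_density_mean_sq:
  assumes "\<kappa> > 0" "\<tau> > 0"
  shows "mean_sq \<kappa> \<tau> 0 = spin_density (\<kappa> / (6 * \<kappa> + \<tau>)) / \<kappa>"
  unfolding mean_sq_eq_series(1)[OF assms] spin_density_def using assms by simp

text \<open>At \<open>\<kappa> = 1\<close> the mean square spin equals
  \<open>spin_density (1 / (6 + \<tau>))\<close>, which is at least \<open>y\<close> for some
  \<open>\<tau>\<close>; the intermediate value theorem starts from
  \<open>spin_density 0 = 0\<close>.\<close>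

lemma spin_density_surj:
  assumes "y > 0"
  shows "\<exists>v. 0 < v \<and> v < 1 / 6 \<and> spin_density v = y"
proof -
  obtain \<tau> where \<tau>: "\<tau> > 0" "mean_sq 1 \<tau> 0 \<ge> y" using mean_sq_unbounded by blast
  define b where "b = 1 / (6 + \<tau>)"
  have b: "0 < b" "b < 1 / 6" using \<tau> by (auto simp: b_def field_simps)
  have yb: "y \<le> spin_density b" using \<tau> spin_density_mean_sq[OF zero_less_one \<tau>(1)] by (simp add: b_def)
  have "isCont spin_density v" if "0 \<le> v" "v \<le> b" for v
    unfolding spin_density_def[abs_def]
    using DERIV_isCont[OF coeff_series_deriv[OF moment_bound[of 0], where z = v]] that b
    by (intro isCont_mult) auto
  moreover have "spin_density 0 = 0" by (simp add: spin_density_def)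
  ultimately obtain v where v: "0 \<le> v" "v \<le> b" "spin_density v = y"
    using IVT[of spin_density 0 y b] yb b assms by auto
  moreover have "v \<noteq> 0" using v assms by (auto simp: spin_density_def)
  ultimately show ?thesis using b by (intro exI[of _ v]) auto
qed

text \<open>The complexified series is locally invertible because its derivative is positive on the
  positive axis. Monotonicity keeps \<open>psi\<close> near \<open>v\<close>, where it must coincide
  with the holomorphic inverse.\<close>

lemma real_analytic_at_spin_density_inverse:
  assumes psi: "\<And>y. y > 0 \<Longrightarrow> 0 < psi y \<and> psi y < 1 / 6 \<and> spin_density (psi y) = y" and y0: "y\<^sub>0 > 0"
  shows "real_analytic_at psi y\<^sub>0"
proof -
  let ?m = "moment 0"
  let ?Ac = "\<lambda>z::complex. \<Sum>n. of_real (?m n) * z ^ n"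
  define f where "f z = z * ?Ac z" for z
  define v where "v = psi y\<^sub>0"
  have v: "0 < v" "v < 1 / 6" "spin_density v = y\<^sub>0" using psi[OF y0] by (auto simp: v_def)
  have hol: "f holomorphic_on ball 0 (1/6)"
    unfolding f_def[abs_def] by (intro holomorphic_intros coeff_series_holomorphic moment_bound)
  have f_real: "f (of_real u) = of_real (spin_density u)" if "0 < u" "u < 1 / 6" for u
    using that by (simp add: f_def spin_density_def coeff_series_of_real[OF moment_bound[of 0]])
  have dnz: "deriv f (of_real v) \<noteq> 0"
  proof -
    let ?D = "\<Sum>n. diffs (\<lambda>n. complex_of_real (?m n)) n * of_real v ^ n"
    have "(f has_field_derivative (1 * ?Ac (of_real v) + ?D * of_real v)) (at (of_real v))"
      unfolding f_def[abs_def]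
      by (intro DERIV_mult DERIV_ident coeff_series_deriv moment_bound) (use v in simp)
    then have d: "deriv f (of_real v) = ?Ac (of_real v) + ?D * of_real v"
      by (simp add: DERIV_imp_deriv)
    have sA: "summable (\<lambda>n. ?m n * u ^ n)" if "\<bar>u\<bar> < 1/6" for u
      using summable_coeff_bound[OF moment_bound[of 0], where z = u] that by simp
    have sD: "summable (\<lambda>n. diffs ?m n * v ^ n)"
      by (rule termdiff_converges[where K = "1/6"]) (use v sA in auto)
    have "?D = of_real (\<Sum>n. diffs ?m n * v ^ n)"
      using suminf_of_real[OF sD, where 'a = complex] by (simp add: diffs_def)
    then have dr: "deriv f (of_real v) = of_real ((\<Sum>n. ?m n * v ^ n) + (\<Sum>n. diffs ?m n * v ^ n) * v)"
      unfolding d using v by (simp add: coeff_series_of_real[OF moment_bound[of 0]])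
    have "(\<Sum>n. ?m n * v ^ n) > 0"
    proof (rule zero_less_mult_pos[OF _ v(1)])
      show "0 < v * (\<Sum>n. ?m n * v ^ n)" using v(3) y0 by (simp add: spin_density_def)
    qed
    moreover have "(\<Sum>n. diffs ?m n * v ^ n) \<ge> 0"
      by (intro suminf_nonneg sD) (use v moment_nonneg in \<open>auto simp: diffs_def\<close>)
    then have "(\<Sum>n. diffs ?m n * v ^ n) * v \<ge> 0" using v by simp
    ultimately have "(\<Sum>n. ?m n * v ^ n) + (\<Sum>n. diffs ?m n * v ^ n) * v \<noteq> 0" by linarith
    with dr show ?thesis by (simp only: of_real_eq_0_iff not_False_eq_True)
  qed
  have vb: "of_real v \<in> ball (0::complex) (1/6)" using v by simp
  obtain r where r: "r > 0" "ball (complex_of_real v) r \<subseteq> ball 0 (1/6)" "open (f ` ball (of_real v) r)"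
      "inj_on f (ball (of_real v) r)"
    by (rule has_complex_derivative_locally_invertible[OF hol vb open_ball dnz])
  obtain g where g: "g holomorphic_on (f ` ball (of_real v) r)"
      "\<And>z. z \<in> ball (of_real v) r \<Longrightarrow> g (f z) = z"
    using holomorphic_has_inverse[OF holomorphic_on_subset[OF hol r(2)] open_ball r(4)] by metis
  show ?thesis unfolding real_analytic_at_def
  proof (intro exI[of _ g] conjI)
    have an: "g analytic_on (f ` ball (of_real v) r)" using g(1) r(3) by (simp add: analytic_on_open)
    have "of_real y\<^sub>0 \<in> f ` ball (of_real v) r"
      using f_real[of v] v r(1) by (intro image_eqI[of _ _ "of_real v"]) auto
    then show "g analytic_on {complex_of_real y\<^sub>0}" by (intro analytic_on_subset[OF an]) simp
    \<comment> \<open>Small enough for the interval of radius \<open>e\<close> about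
      \<open>v\<close> to stay both in \<open>(0, 1/6)\<close> and in the disc on which
      \<open>f\<close> is injective.\<close>
    define e where "e = min (r / 2) (min (v / 2) (1 / 12 - v / 2))"
    have e: "0 < e" "e < r" "e < v" "v + e < 1 / 6"
    proof -
      have "e \<le> r / 2" "e \<le> v / 2" "e \<le> 1 / 12 - v / 2" unfolding e_def by linarith+
      then show "e < r" "e < v" "v + e < 1 / 6" using v r(1) by linarith+
      show "0 < e" using v r(1) unfolding e_def by simp
    qed
    have "\<forall>\<^sub>F y in nhds y\<^sub>0. y \<in> {spin_density (v - e)<..<spin_density (v + e)}"
    proof (intro eventually_nhds_in_open)
      show "y\<^sub>0 \<in> {spin_density (v - e)<..<spin_density (v + e)}"
        using spin_density_less[of "v - e" v] spin_density_less[of v "v + e"] e v by auto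
    qed auto
    then show "\<forall>\<^sub>F y in nhds y\<^sub>0. g (of_real y) = of_real (psi y)"
    proof eventually_elim
      case (elim y)
      have "spin_density (v - e) > spin_density 0" using spin_density_less[of 0 "v - e"] e v by auto
      then have y: "y > 0" using elim by (simp add: spin_density_def)
      note p = psi[OF y]
      have "v - e < psi y"
      proof (rule ccontr)
        assume "\<not> v - e < psi y"
        then have "spin_density (psi y) \<le> spin_density (v - e)"
          using spin_density_mono_strong[of "psi y" "v - e"] p e v by simp
        then show False using p elim by simp
      qed
      moreover have "psi y < v + e"
      proof (rule ccontr)
        assume "\<not> psi y < v + e"
        then have "spin_density (v + e) \<le> spin_density (psi y)"
          using spin_density_mono_strong[of "v + e" "psi y"] p e v by simp
        then show False using p elim by simp
      qed
      ultimately have "dist (of_real v) (complex_of_real (psi y)) < r"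
        using e by (simp add: dist_norm flip: of_real_diff)
      then have "g (f (of_real (psi y))) = of_real (psi y)" using g(2) by simp
      then show ?case using f_real[of "psi y"] p by simp
    qed
  qed
qed


section \<open>Gibbs expectations in terms of the Gaussian model\<close>

lemma gibbs_expect_constraint:
  assumes "L > 0" "\<beta> * J > 0" "\<mu> > 0"
  shows "gibbs_expect J L \<beta> \<mu> (constraint L) / real L ^ 3 = mean_sq (\<beta> * J) (2 * \<mu>) L"
proof -
  have m: "2 * \<mu> > 0" using assms by simp
  show ?thesis
    unfolding gibbs_expect_def partition_fn_eq[OF assms(1)] gibbs_weight_eq[OF assms(1)]
      constraint_moment(2)[OF assms(1,2) m]
    using gauss_partition_pos[OF assms(1,2) m] assms(1) by simp
qed

text \<open>Exact at every finite \<open>L\<close>: each of the two components contributes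
  \<open>1 / (2 \<mu>)\<close> per site.\<close>

lemma gibbs_expect_mean_spin:
  assumes "L > 0" "\<beta> * J > 0" "\<mu> > 0"
  shows "gibbs_expect J L \<beta> \<mu> (\<lambda>S. (norm ((1 / real L ^ 3) *\<^sub>R (\<Sum>r\<in>sites L. S r)))\<^sup>2) = 1 / \<mu> / real L ^ 3"
proof -
  have m: "2 * \<mu> > 0" using assms by simp
  let ?w = "gauss_weight (\<beta> * J) (2 * \<mu>) L"
  let ?X = "\<lambda>S. \<Sum>r\<in>sites L. S r"
  note t = total_spin_moment[OF assms(1,2) m]
  have n2: "(norm X)\<^sup>2 = (X \<bullet> (1, 0))\<^sup>2 + (X \<bullet> (0, 1))\<^sup>2" for X :: "real \<times> real"
    by (cases X) (simp add: norm_Pair)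
  have e: "(norm ((1 / real L ^ 3) *\<^sub>R ?X S))\<^sup>2 * ?w S
     = (1 / real L ^ 3)\<^sup>2 * ((?X S \<bullet> (1, 0))\<^sup>2 * ?w S + (?X S \<bullet> (0, 1))\<^sup>2 * ?w S)" for S
    by (simp only: norm_scaleR power_mult_distrib n2 real_norm_def power2_abs distrib_left distrib_right mult.assoc)
  have "(\<integral>S. (norm ((1 / real L ^ 3) *\<^sub>R ?X S))\<^sup>2 * ?w S \<partial>config_measure L)
     = (1 / real L ^ 3)\<^sup>2 * (real L ^ 3 * ((1 :: real, 0 :: real) \<bullet> (1, 0)) / (2 * \<mu>) * gauss_partition (\<beta> * J) (2 * \<mu>) L
        + real L ^ 3 * ((0 :: real, 1 :: real) \<bullet> (0, 1)) / (2 * \<mu>) * gauss_partition (\<beta> * J) (2 * \<mu>) L)"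
    unfolding e integral_mult_right_zero
      Bochner_Integration.integral_add[OF t(1)[of "(1, 0)"] t(1)[of "(0, 1)"]] t(2) ..
  also have "\<dots> = 1 / \<mu> / real L ^ 3 * gauss_partition (\<beta> * J) (2 * \<mu>) L"
  proof -
    have alg: "(1 / l)\<^sup>2 * (l * a / (2 * \<mu>) * z + l * b / (2 * \<mu>) * z) = (a + b) / 2 / \<mu> / l * z"
      if "l \<noteq> 0" for l a b z :: real
      using that assms(3) by (simp add: power2_eq_square field_simps)
    show ?thesis using assms(1) by (subst alg) simp_all
  qed
  finally show ?thesis
    unfolding gibbs_expect_def partition_fn_eq[OF assms(1)] gibbs_weight_eq[OF assms(1)]
    using gauss_partition_pos[OF assms(1,2) m] by simp
qed

lemma gibbs_expect_pair:
  assumes "L > 0" "\<beta> * J > 0" "\<mu> > 0"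
    and "\<And>x. p x = x \<bullet> w" "\<And>x. q x = x \<bullet> w'"
  shows "gibbs_expect J L \<beta> \<mu> (\<lambda>S. p (S (site_of L r)) * q (S (site_of L r')))
    = resolvent (\<beta> * J) (2 * \<mu>) L r' w' r \<bullet> w"
proof -
  have m: "2 * \<mu> > 0" using assms by simp
  have e: "p (S (site_of L r)) * q (S (site_of L r')) = (lift_config L S r \<bullet> w) * (lift_config L S r' \<bullet> w')" for S
    by (simp only: assms(4,5) lift_config_def)
  show ?thesis
    unfolding gibbs_expect_def partition_fn_eq[OF assms(1)] gibbs_weight_eq[OF assms(1)] e
      covariance(2)[OF assms(1,2) m]
    using gauss_partition_pos[OF assms(1,2) m] by simp
qed

theorem theorem7p1:
  fixes J :: real
  assumes "J > 0"
  shows "\<exists>\<mu>\<^sub>s :: real \<Rightarrow> real.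
    real_analytic_on \<mu>\<^sub>s {0<..} \<and> (\<forall>\<beta>>0. \<mu>\<^sub>s \<beta> > 0) \<and>
    (\<forall>\<beta>>0.
       ((\<lambda>L. gibbs_expect J L \<beta> (\<mu>\<^sub>s \<beta>) (constraint L) / real L ^ 3) \<longlonglongrightarrow> 1) \<and>
       ((\<lambda>L. gibbs_expect J L \<beta> (\<mu>\<^sub>s \<beta>)
           (\<lambda>S. (norm ((1 / real L ^ 3) *\<^sub>R (\<Sum>r\<in>sites L. S r)))^2)) \<longlonglongrightarrow> 0) \<and>
       (\<forall>p\<in>{fst, snd}. \<forall>q\<in>{fst, snd}. \<exists>g :: int \<times> int \<times> int \<Rightarrow> int \<times> int \<times> int \<Rightarrow> real.
          (\<forall>r r'. (\<lambda>L. gibbs_expect J L \<beta> (\<mu>\<^sub>s \<beta>)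
                      (\<lambda>S. p (S (site_of L r)) * q (S (site_of L r')))) \<longlonglongrightarrow> g r r') \<and>
          (\<forall>\<epsilon>>0. \<exists>R. \<forall>r r'. euclid_dist3 r r' \<ge> R \<longrightarrow> \<bar>g r r'\<bar> < \<epsilon>))) \<and>
    (\<exists>F :: real \<Rightarrow> real. real_analytic_on F {0<..} \<and>
       (\<forall>\<beta>>0. (\<lambda>L. ln (partition_fn J L \<beta> (\<mu>\<^sub>s \<beta>)) / real L ^ 3) \<longlonglongrightarrow> F \<beta>))"
proof -
  define psi where "psi y = (SOME v. 0 < v \<and> v < 1 / 6 \<and> spin_density v = y)" for y
  have psi: "0 < psi y \<and> psi y < 1 / 6 \<and> spin_density (psi y) = y" if "y > 0" for y
    unfolding psi_def by (rule someI_ex[OF spin_density_surj[OF that]])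
  define v where "v \<beta> = psi (\<beta> * J)" for \<beta>
  \<comment> \<open>The solution of \<open>\<kappa> / (6 \<kappa> + 2 \<mu>) = v\<close> with
    \<open>\<kappa> = \<beta> * J\<close>, written with sums, products and \<open>inverse\<close> to
    fit the closure lemmas. It is positive because \<open>v < 1/6\<close>.\<close>
  define \<mu> where "\<mu> \<beta> = \<beta> * J * inverse (v \<beta>) * (1 / 2) + (- 3) * (\<beta> * J)" for \<beta>
  \<comment> \<open>The limit of \<open>free_energy_finite\<close>, where
    \<open>6 \<kappa> + 2 \<mu>\<close> has become \<open>\<kappa> / v\<close>.\<close>
  define F where "F \<beta> = ln (2 * pi) + ((- 1) * ln (\<beta> * J * inverse (v \<beta>)) + log_series 0 (v \<beta>) * (1 / 2))" for \<beta>
  have \<kappa>: "\<beta> * J > 0" if "\<beta> > 0" for \<beta> using that assms by simp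
  have v: "0 < v \<beta>" "v \<beta> < 1 / 6" "spin_density (v \<beta>) = \<beta> * J" if "\<beta> > 0" for \<beta>
    using psi[OF \<kappa>[OF that]] by (simp_all add: v_def)
  have T: "6 * (\<beta> * J) + 2 * \<mu> \<beta> = \<beta> * J / v \<beta>" for \<beta>
    by (simp add: \<mu>_def divide_inverse[of "\<beta> * J" "v \<beta>"])
  have \<mu>: "\<mu> \<beta> > 0" if "\<beta> > 0" for \<beta>
  proof -
    have "\<beta> * J * (6 * v \<beta>) < \<beta> * J * 1"
      using v(2)[OF that] \<kappa>[OF that] by (intro mult_strict_left_mono) auto
    then have "6 * (\<beta> * J) * v \<beta> < \<beta> * J" by (simp only: mult_ac mult_1_right)
    then have "6 * (\<beta> * J) < \<beta> * J / v \<beta>"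
      using v(1)[OF that] by (simp only: pos_less_divide_eq)
    then show ?thesis using T[of \<beta>] by linarith
  qed
  have \<tau>: "2 * \<mu> \<beta> > 0" if "\<beta> > 0" for \<beta> using \<mu>[OF that] by simp
  have vT: "\<beta> * J / (6 * (\<beta> * J) + 2 * \<mu> \<beta>) = v \<beta>" if "\<beta> > 0" for \<beta>
    unfolding T using v(1)[OF that] that assms by simp
  have analytic_kappa: "real_analytic_at (\<lambda>\<beta>. \<beta> * J) \<beta>" for \<beta> by (intro real_analytic_at_mult real_analytic_at_ident real_analytic_at_const)
  have analytic_v: "real_analytic_at v \<beta>" if "\<beta> > 0" for \<beta>
    unfolding v_def[abs_def] by (rule real_analytic_at_compose[OF analytic_kappa real_analytic_at_spin_density_inverse[OF psi \<kappa>[OF that]]])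
  have analytic_inv: "real_analytic_at (\<lambda>\<beta>. \<beta> * J * inverse (v \<beta>)) \<beta>" if "\<beta> > 0" for \<beta>
    using v(1)[OF that] by (intro real_analytic_at_mult real_analytic_at_ident real_analytic_at_const real_analytic_at_inverse analytic_v that) simp
  have "real_analytic_on \<mu> {0<..}"
  proof (rule real_analytic_onI)
    fix \<beta> :: real assume "\<beta> \<in> {0<..}"
    then have "\<beta> > 0" by simp
    then show "real_analytic_at \<mu> \<beta>" unfolding \<mu>_def[abs_def]
      by (intro real_analytic_at_add analytic_inv analytic_kappa real_analytic_at_mult[OF analytic_inv real_analytic_at_const] real_analytic_at_mult[OF real_analytic_at_const analytic_kappa])
  qed
  moreover have "real_analytic_on F {0<..}"
  proof (rule real_analytic_onI)
    fix \<beta> :: real assume "\<beta> \<in> {0<..}"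
    then have b: "\<beta> > 0" by simp
    have "real_analytic_at (\<lambda>\<beta>. ln (\<beta> * J * inverse (v \<beta>))) \<beta>"
      using v(1)[OF b] \<kappa>[OF b] by (intro real_analytic_at_compose[OF analytic_inv[OF b]] real_analytic_at_ln) simp
    moreover have "real_analytic_at (log_series 0) (v \<beta>)"
      unfolding log_series_def[abs_def] using v[OF b] by (intro real_analytic_at_coeff_series moment_div_bound) simp
    then have "real_analytic_at (\<lambda>\<beta>. log_series 0 (v \<beta>)) \<beta>" by (rule real_analytic_at_compose[OF analytic_v[OF b]])
    ultimately show "real_analytic_at F \<beta>" unfolding F_def[abs_def]
      by (intro real_analytic_at_add real_analytic_at_const real_analytic_at_mult[OF real_analytic_at_const] real_analytic_at_mult[OF _ real_analytic_at_const])
  qed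
  moreover have "(\<lambda>L. ln (partition_fn J L \<beta> (\<mu> \<beta>)) / real L ^ 3) \<longlonglongrightarrow> F \<beta>" if b: "\<beta> > 0" for \<beta>
  proof -
    have lim: "(\<lambda>L. ln (2 * pi) - ln (\<beta> * J / v \<beta>) + log_series L (v \<beta>) / 2) \<longlonglongrightarrow> ln (2 * pi) - ln (\<beta> * J / v \<beta>) + log_series 0 (v \<beta>) / 2"
      using v[OF b] by (intro tendsto_intros log_series_tendsto) auto
    have FF: "ln (2 * pi) - ln (\<beta> * J / v \<beta>) + log_series 0 (v \<beta>) / 2 = F \<beta>"
      by (simp add: F_def divide_inverse[of "\<beta> * J" "v \<beta>"])
    have "\<forall>\<^sub>F L in sequentially. ln (2 * pi) - ln (\<beta> * J / v \<beta>) + log_series L (v \<beta>) / 2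
        = ln (partition_fn J L \<beta> (\<mu> \<beta>)) / real L ^ 3"
      using eventually_gt_at_top[of 0]
    proof eventually_elim
      case (elim L)
      show ?case
        unfolding partition_fn_eq[OF elim] free_energy_finite[OF elim \<kappa>[OF b] \<tau>[OF b]] vT[OF b] unfolding T ..
    qed
    then show ?thesis by (rule Lim_transform_eventually[OF lim[unfolded FF]])
  qed
  moreover have "(\<lambda>L. gibbs_expect J L \<beta> (\<mu> \<beta>) (constraint L) / real L ^ 3) \<longlonglongrightarrow> 1" if b: "\<beta> > 0" for \<beta>
  proof -
    \<comment> \<open>The limiting constraint is \<open>spin_density (v \<beta>) / \<kappa>\<close>,
      and \<open>v\<close> was chosen to make this 1.\<close>
    have "mean_sq (\<beta> * J) (2 * \<mu> \<beta>) 0 = 1"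
      unfolding spin_density_mean_sq[OF \<kappa>[OF b] \<tau>[OF b]] vT[OF b] v(3)[OF b] using b assms by simp
    then have lim: "mean_sq (\<beta> * J) (2 * \<mu> \<beta>) \<longlonglongrightarrow> 1"
      using mean_sq_tendsto[OF \<kappa>[OF b] \<tau>[OF b]] by simp
    have "\<forall>\<^sub>F L in sequentially. mean_sq (\<beta> * J) (2 * \<mu> \<beta>) L = gibbs_expect J L \<beta> (\<mu> \<beta>) (constraint L) / real L ^ 3"
      using eventually_gt_at_top[of 0]
      by eventually_elim (rule gibbs_expect_constraint[symmetric, OF _ \<kappa>[OF b] \<mu>[OF b]])
    then show ?thesis by (rule Lim_transform_eventually[OF lim])
  qed
  moreover have "(\<lambda>L. gibbs_expect J L \<beta> (\<mu> \<beta>)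
           (\<lambda>S. (norm ((1 / real L ^ 3) *\<^sub>R (\<Sum>r\<in>sites L. S r)))^2)) \<longlonglongrightarrow> 0" if b: "\<beta> > 0" for \<beta>
  proof -
    have lim: "(\<lambda>L. 1 / \<mu> \<beta> / real L ^ 3) \<longlonglongrightarrow> 0"
      by real_asymp
    have "\<forall>\<^sub>F L in sequentially. 1 / \<mu> \<beta> / real L ^ 3 = gibbs_expect J L \<beta> (\<mu> \<beta>)
           (\<lambda>S. (norm ((1 / real L ^ 3) *\<^sub>R (\<Sum>r\<in>sites L. S r)))^2)"
      using eventually_gt_at_top[of 0]
      by eventually_elim (rule gibbs_expect_mean_spin[symmetric, OF _ \<kappa>[OF b] \<mu>[OF b]])
    then show ?thesis by (rule Lim_transform_eventually[OF lim])
  qed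
  moreover have "\<exists>g. (\<forall>r r'. (\<lambda>L. gibbs_expect J L \<beta> (\<mu> \<beta>)
                      (\<lambda>S. p (S (site_of L r)) * q (S (site_of L r')))) \<longlonglongrightarrow> g r r') \<and>
          (\<forall>\<epsilon>>0. \<exists>R. \<forall>r r'. euclid_dist3 r r' \<ge> R \<longrightarrow> \<bar>g r r'\<bar> < \<epsilon>)"
    if b: "\<beta> > 0" and pq: "p \<in> {fst, snd}" "q \<in> {fst, snd}" for \<beta> and p q :: "real \<times> real \<Rightarrow> real"
  proof -
    \<comment> \<open>Coordinates are inner products with basis vectors, which covers all four
      choices of components at once.\<close>
    have repr: "\<exists>w. \<forall>x. p x = x \<bullet> w" if "p \<in> {fst, snd}" for p :: "real \<times> real \<Rightarrow> real"
    proof (cases "p = fst")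
      case True
      then show ?thesis by (intro exI[of _ "(1, 0)"]) (simp add: inner_prod_def)
    next
      case False
      with that show ?thesis by (intro exI[of _ "(0, 1)"]) (simp add: inner_prod_def)
    qed
    obtain w w' where w: "\<And>x. p x = x \<bullet> w" and w': "\<And>x. q x = x \<bullet> w'"
      using repr[OF pq(1)] repr[OF pq(2)] by blast
    let ?g = "\<lambda>r r'. resolvent (\<beta> * J) (2 * \<mu> \<beta>) 0 r' w' r \<bullet> w"
    have "(\<lambda>L. gibbs_expect J L \<beta> (\<mu> \<beta>) (\<lambda>S. p (S (site_of L r)) * q (S (site_of L r')))) \<longlonglongrightarrow> ?g r r'" for r r'
    proof (rule Lim_transform_eventually[OF resolvent_tendsto[OF \<kappa>[OF b] \<tau>[OF b]]])
      show "\<forall>\<^sub>F L in sequentially. resolvent (\<beta> * J) (2 * \<mu> \<beta>) L r' w' r \<bullet> w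
         = gibbs_expect J L \<beta> (\<mu> \<beta>) (\<lambda>S. p (S (site_of L r)) * q (S (site_of L r')))"
        using eventually_gt_at_top[of 0]
        by eventually_elim (rule gibbs_expect_pair[symmetric, OF _ \<kappa>[OF b] \<mu>[OF b] w w'])
    qed
    moreover have "\<exists>R. \<forall>r r'. euclid_dist3 r r' \<ge> R \<longrightarrow> \<bar>?g r r'\<bar> < \<epsilon>" if "\<epsilon> > 0" for \<epsilon>
      by (rule resolvent_decay[OF \<kappa>[OF b] \<tau>[OF b] that])
    ultimately show ?thesis by (intro exI[of _ ?g]) blast
  qed
  ultimately show ?thesis
    using \<mu> by (intro exI[of _ \<mu>]) blast
qed

end
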